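(* Let $n,m\in\mathbb N$, $d:=\min\{n,m\}$, fix $\alpha\in[1,d]$, and write $k:=\lfloor\alpha\rfloor$, $\theta:=\alpha-k\in[0,1)$. Let $\Phi:\mathbb M_n\to\mathbb M_m$ be linear. The following are equivalent: (i) $\Phi$ is $\alpha$-superpositive, i.e. $C_\Phi\in\mathsf K_\alpha$; (ii) there exist $N\in\mathbb N$ and $\alpha$-admissible matrices $A_1,\dots,A_N\in\mathbb M_{m,n}$ such that $\Phi(X)=\sum_{i=1}^N A_iXA_i^\ast$ for all $X\in\mathbb M_n$; (iii) there exist $N\in\mathbb N$, vectors $\psi_1,\dots,\psi_N\in\mathcal V_\alpha$ and scalars $t_1,\dots,t_N>0$ such that $C_\Phi=\sum_{i=1}^N t_i\psi_i\psi_i^\ast$. Moreover, in (iii) one may choose $N\le (nm)^2$. In particular, the $\alpha$-superpositive maps are precisely the completely positive maps admitting a Kraus decomposition with $\alpha$-admissible Kraus operators.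
   Context: Standard bases: $\{e_i\}$ of $\mathbb C^n$, $\{f_j\}$ of $\mathbb C^m$; $E_{ij}$ are the matrix units of $\mathbb M_n$. The Choi matrix of a linear $\Phi:\mathbb M_n\to\mathbb M_m$ is $C_\Phi=\sum_{i,j=1}^nE_{ij}\otimes\Phi(E_{ij})\in\mathbb M_n\otimes\mathbb M_m$. For $\psi=\sum_{i,j}a_{ij}e_i\otimes f_j\in\mathbb C^n\otimes\mathbb C^m$, its Schmidt coefficients $s_1(\psi)\ge\dots\ge s_d(\psi)\ge0$ are the singular values of the $n\times m$ matrix $[a_{ij}]$. For $\alpha\in[1,d]$ with $k=\lfloor\alpha\rfloor$, $\theta=\alpha-k$, $r=\lceil\alpha\rceil$: a unit vector $\psi$ is $\alpha$-admissible if $s_j(\psi)=0$ for all $j\ge r+1$ and, when $\theta>0$, $s_{k+1}(\psi)\le\frac{\theta}{k}\sum_{j=1}^ks_j(\psi)$; $\mathcal V_\alpha$ denotes the set of such unit vectors. A matrix $A\in\mathbb M_{m,n}$ with singular values $\sigma_1(A)\ge\sigma_2(A)\ge\cdots$ is $\alpha$-admissible if $\sigma_j(A)=0$ for all $j\ge r+1$ and, when $\theta>0$, $\sigma_{k+1}(A)\le\frac{\theta}{k}\sum_{j=1}^k\sigma_j(A)$. $\mathsf K_\alpha$ is the closure of the convex cone $\{\sum_i t_i\psi_i\psi_i^\ast: t_i\ge0,\psi_i\in\mathcal V_\alpha\}$ (finite sums) in $\mathbb M_n\otimes\mathbb M_m$. *)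

theory Defs
  imports "Jordan_Normal_Form.Schur_Decomposition" "Jordan_Normal_Form.Char_Poly"
          "HOL-Computational_Algebra.Polynomial" "HOL-Library.Multiset"
begin

definition msum :: "nat \<Rightarrow> nat \<Rightarrow> (nat \<Rightarrow> complex mat) \<Rightarrow> nat \<Rightarrow> complex mat" where
  "msum r c f N = mat r c (\<lambda>(p,q). \<Sum>i<N. f i $$ (p,q))"

definition sing_list :: "complex mat \<Rightarrow> real list" where
  "sing_list A = rev (sorted_list_of_multiset
      (image_mset (\<lambda>z. sqrt (Re z)) (proots (char_poly (mat_adjoint A * A)))))"

definition sing_val :: "complex mat \<Rightarrow> nat \<Rightarrow> real" where
  "sing_val A j = (if 1 \<le> j \<and> j \<le> length (sing_list A) then sing_list A ! (j - 1) else 0)"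

(* alpha-admissibility of a non-increasing sequence s_1 \<ge> s_2 \<ge> ... (1-indexed) *)
definition adm_seq :: "real \<Rightarrow> (nat \<Rightarrow> real) \<Rightarrow> bool" where
  "adm_seq \<alpha> s \<longleftrightarrow>
     (let k = nat \<lfloor>\<alpha>\<rfloor>; \<theta> = \<alpha> - real k; r = nat \<lceil>\<alpha>\<rceil> in
       (\<forall>j. j \<ge> r + 1 \<longrightarrow> s j = 0) \<and>
       (\<theta> > 0 \<longrightarrow> s (k + 1) \<le> \<theta> / real k * (\<Sum>j=1..k. s j)))"

definition adm_mat :: "real \<Rightarrow> complex mat \<Rightarrow> bool" where
  "adm_mat \<alpha> A \<longleftrightarrow> adm_seq \<alpha> (sing_val A)"

(* Vectors of C^n \<otimes> C^m are vectors of dimension n*m, with e_i \<otimes> f_j at index i*m + j.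
   Coefficient matrix [a_ij] (n x m) of psi. *)
definition coef_mat :: "nat \<Rightarrow> nat \<Rightarrow> complex vec \<Rightarrow> complex mat" where
  "coef_mat n m \<psi> = mat n m (\<lambda>(i,j). \<psi> $ (i * m + j))"

definition schmidt :: "nat \<Rightarrow> nat \<Rightarrow> complex vec \<Rightarrow> nat \<Rightarrow> real" where
  "schmidt n m \<psi> = sing_val (coef_mat n m \<psi>)"

definition unit_vec_nm :: "nat \<Rightarrow> nat \<Rightarrow> complex vec \<Rightarrow> bool" where
  "unit_vec_nm n m \<psi> \<longleftrightarrow> \<psi> \<in> carrier_vec (n * m) \<and> (\<Sum>i<n * m. (cmod (\<psi> $ i))\<^sup>2) = 1"

definition V_alpha :: "nat \<Rightarrow> nat \<Rightarrow> real \<Rightarrow> complex vec set" where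
  "V_alpha n m \<alpha> = {\<psi>. unit_vec_nm n m \<psi> \<and> adm_seq \<alpha> (schmidt n m \<psi>)}"

definition proj :: "complex vec \<Rightarrow> complex mat" where
  "proj \<psi> = mat (dim_vec \<psi>) (dim_vec \<psi>) (\<lambda>(i,j). \<psi> $ i * cnj (\<psi> $ j))"

definition cone_alpha :: "nat \<Rightarrow> nat \<Rightarrow> real \<Rightarrow> complex mat set" where
  "cone_alpha n m \<alpha> = {msum (n*m) (n*m) (\<lambda>i. complex_of_real (t i) \<cdot>\<^sub>m proj (\<psi> i)) N | N t \<psi>.
       \<forall>i<N. t i \<ge> 0 \<and> \<psi> i \<in> V_alpha n m \<alpha>}"

(* K_alpha: closure of the cone in M_n \<otimes> M_m = M_{nm} (entrywise = norm topology) *)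
definition K_alpha :: "nat \<Rightarrow> nat \<Rightarrow> real \<Rightarrow> complex mat set" where
  "K_alpha n m \<alpha> = {C. C \<in> carrier_mat (n*m) (n*m) \<and>
     (\<exists>X. (\<forall>l. X l \<in> cone_alpha n m \<alpha>) \<and>
          (\<forall>p<n*m. \<forall>q<n*m. (\<lambda>l. X l $$ (p,q)) \<longlonglongrightarrow> C $$ (p,q)))}"

definition E_unit :: "nat \<Rightarrow> nat \<Rightarrow> nat \<Rightarrow> complex mat" where
  "E_unit n i j = mat n n (\<lambda>(a,b). if a = i \<and> b = j then 1 else 0)"

(* Choi matrix C_Phi = \<Sum>_{ij} E_ij \<otimes> Phi(E_ij) (Kronecker ordering) *)
definition choi :: "nat \<Rightarrow> nat \<Rightarrow> (complex mat \<Rightarrow> complex mat) \<Rightarrow> complex mat" where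
  "choi n m \<Phi> = mat (n*m) (n*m)
     (\<lambda>(p,q). \<Phi> (E_unit n (p div m) (q div m)) $$ (p mod m, q mod m))"

definition lin_map :: "nat \<Rightarrow> nat \<Rightarrow> (complex mat \<Rightarrow> complex mat) \<Rightarrow> bool" where
  "lin_map n m \<Phi> \<longleftrightarrow>
     (\<forall>X \<in> carrier_mat n n. \<Phi> X \<in> carrier_mat m m) \<and>
     (\<forall>X \<in> carrier_mat n n. \<forall>Y \<in> carrier_mat n n. \<Phi> (X + Y) = \<Phi> X + \<Phi> Y) \<and>
     (\<forall>c. \<forall>X \<in> carrier_mat n n. \<Phi> (c \<cdot>\<^sub>m X) = c \<cdot>\<^sub>m \<Phi> X)"

end

theory Submission
  imports Defs
begin

text \<open>Absorbing a weight \<open>t\<close> into \<open>\<surd>t \<psi>\<close>, all three conditions speak about writing the Choi matrix as a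
  finite sum of \<open>\<phi>\<phi>\<^sup>*\<close> with admissible, not necessarily normalised, vectors \<open>\<phi>\<close>; admissibility is
  invariant under scaling. A Kraus operator \<open>A\<close> corresponds to the vector \<open>\<phi>\<close> whose coefficient matrix is the
  transpose of \<open>A\<close>, and \<open>A\<close> and its transpose have the same nonzero singular values.

  The only analytic point is that the cone is already closed. By Caratheodory's theorem in the
  \<open>(nm)\<^sup>2\<close>-dimensional real space of Hermitian matrices, every element is a sum of \<open>(nm)\<^sup>2\<close> terms
  \<open>\<phi>\<phi>\<^sup>*\<close>. Along a convergent sequence in the cone the diagonal entries bound all these vectors, so
  they converge along a subsequence, and limits of admissible vectors are admissible because the
  singular values of bounded matrices are bounded and determined by the characteristic polynomial of
  \<open>A\<^sup>*A\<close>, which depends continuously on \<open>A\<close>.\<close>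

subsection \<open>Singular values\<close>

lemma mat_adjoint_carrier [simp]:
  "A \<in> carrier_mat r c \<Longrightarrow> mat_adjoint A \<in> carrier_mat c r"
  by (auto simp: mat_adjoint_def)

lemma mat_adjoint_index:
  assumes "A \<in> carrier_mat r c" "i < c" "j < r"
  shows "mat_adjoint A $$ (i, j) = conjugate (A $$ (j, i))"
  using assms by (auto simp: mat_adjoint_def mat_of_rows_def)

lemma mat_mult_index_sum:
  assumes "A \<in> carrier_mat r n" "B \<in> carrier_mat n c" "i < r" "j < c"
  shows "(A * B) $$ (i, j) = (\<Sum>l<n. A $$ (i, l) * B $$ (l, j))"
  using assms by (auto simp: scalar_prod_def lessThan_atLeast0 intro!: sum.cong)

lemma gram_carrier [simp]:
  "A \<in> carrier_mat r c \<Longrightarrow> mat_adjoint A * A \<in> carrier_mat c c"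
  using mat_adjoint_carrier[of A r c] by (metis mult_carrier_mat)

lemma gram_index:
  fixes A :: "complex mat"
  assumes "A \<in> carrier_mat r c" "i < c" "j < c"
  shows "(mat_adjoint A * A) $$ (i, j) = (\<Sum>l<r. cnj (A $$ (l, i)) * A $$ (l, j))"
  using assms by (simp add: mat_mult_index_sum[of _ c r _ c] mat_adjoint_index[of _ r c])

text \<open>Turns values of the characteristic polynomial into determinants, where the scaling,
  block-matrix and limit arguments all take place.\<close>

lemma poly_char_poly:
  fixes A :: "'a :: field mat"
  assumes A: "A \<in> carrier_mat n n"
  shows "poly (char_poly A) z = det (z \<cdot>\<^sub>m 1\<^sub>m n - A)"
proof -
  have "- char_matrix A z = z \<cdot>\<^sub>m 1\<^sub>m n - A"
    using A by (intro eq_matI) (auto simp: char_matrix_def)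
  thus ?thesis using char_poly_matrix[OF A] by simp
qed

text \<open>An eigenvector \<open>v\<close> of \<open>A\<^sup>*A\<close> with eigenvalue \<open>z\<close> satisfies \<open>z |v|\<^sup>2 = |A v|\<^sup>2\<close>.\<close>

lemma eigenvalue_gram_nonneg:
  fixes A :: "complex mat"
  assumes A: "A \<in> carrier_mat r c" and ev: "eigenvalue (mat_adjoint A * A) z"
  shows "z = complex_of_real (Re z) \<and> 0 \<le> Re z"
proof -
  let ?G = "mat_adjoint A * A"
  have G: "?G \<in> carrier_mat c c" using A by simp
  from ev G obtain v where v: "v \<in> carrier_vec c" "v \<noteq> 0\<^sub>v c"
    and e: "?G *\<^sub>v v = z \<cdot>\<^sub>v v"
    unfolding eigenvalue_def eigenvector_def by auto
  \<comment> \<open>\<open>w\<close> is A v in coordinates; expanding v^* A^* A v gives the sum of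
    all |w_l|^2.\<close>
  define w where "w l = (\<Sum>j<c. A $$ (l, j) * v $ j)" for l
  have Gv: "(\<Sum>j<c. (\<Sum>l<r. cnj (A $$ (l, i)) * A $$ (l, j)) * v $ j) = z * v $ i"
    if i: "i < c" for i
  proof -
    have "z * v $ i = (?G *\<^sub>v v) $ i" using e v i by simp
    also have "\<dots> = (\<Sum>j<c. ?G $$ (i, j) * v $ j)"
      using i G v by (auto simp: mult_mat_vec_def scalar_prod_def lessThan_atLeast0 simp del: index_mult_mat)
    finally show ?thesis using gram_index[OF A i] by simp
  qed
  have "z * (\<Sum>i<c. v $ i * cnj (v $ i)) = (\<Sum>i<c. cnj (v $ i) * (z * v $ i))"
    by (simp add: sum_distrib_left mult_ac)
  also have "\<dots> = (\<Sum>i<c. cnj (v $ i) * (\<Sum>j<c. (\<Sum>l<r. cnj (A $$ (l, i)) * A $$ (l, j)) * v $ j))"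
    using Gv by simp
  also have "\<dots> = (\<Sum>i<c. \<Sum>j<c. \<Sum>l<r. cnj (A $$ (l, i)) * cnj (v $ i) * (A $$ (l, j) * v $ j))"
    by (simp add: sum_distrib_left sum_distrib_right mult_ac)
  also have "\<dots> = (\<Sum>i<c. \<Sum>l<r. \<Sum>j<c. cnj (A $$ (l, i)) * cnj (v $ i) * (A $$ (l, j) * v $ j))"
    by (intro sum.cong refl sum.swap)
  also have "\<dots> = (\<Sum>l<r. \<Sum>i<c. \<Sum>j<c. cnj (A $$ (l, i)) * cnj (v $ i) * (A $$ (l, j) * v $ j))"
    by (rule sum.swap)
  also have "\<dots> = (\<Sum>l<r. cnj (w l) * w l)"
    by (simp add: w_def sum_product)
  finally have eq: "z * complex_of_real (\<Sum>i<c. (cmod (v $ i))\<^sup>2) = complex_of_real (\<Sum>l<r. (cmod (w l))\<^sup>2)"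
    by (simp only: of_real_sum complex_norm_square mult.commute[of "cnj _"])
  obtain i where "i < c" "v $ i \<noteq> 0" using v by (metis carrier_vecD eq_vecI index_zero_vec)
  hence pos: "(\<Sum>i<c. (cmod (v $ i))\<^sup>2) > 0"
    by (intro sum_pos2[of _ i]) auto
  have "z = complex_of_real ((\<Sum>l<r. (cmod (w l))\<^sup>2) / (\<Sum>i<c. (cmod (v $ i))\<^sup>2))"
    using eq pos by (simp only: of_real_divide nonzero_eq_divide_eq of_real_eq_0_iff less_imp_neq[OF pos, symmetric] not_False_eq_True)
  moreover have "(\<Sum>l<r. (cmod (w l))\<^sup>2) / (\<Sum>i<c. (cmod (v $ i))\<^sup>2) \<ge> 0"
    using pos by (intro divide_nonneg_pos sum_nonneg) auto
  ultimately show ?thesis by (metis Re_complex_of_real)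
qed

text \<open>Lets characteristic polynomials be compared pointwise, since the determinant formulas
  speak only about values.\<close>

lemma poly_ext: "(\<And>z. poly p z = poly q z) \<Longrightarrow> p = (q :: complex poly)"
  by (simp add: poly_eq_poly_eq_iff[symmetric] fun_eq_iff)

text \<open>A certificate for \<open>sing_list\<close>: identifying a candidate list reduces to its
  order, its signs and a polynomial identity. Zero singular values are listed with
  multiplicity.\<close>

definition is_sing_list :: "complex mat \<Rightarrow> real list \<Rightarrow> bool" where
  "is_sing_list A s \<longleftrightarrow> sorted (rev s) \<and> (\<forall>x\<in>set s. 0 \<le> x) \<and>
     char_poly (mat_adjoint A * A) = (\<Prod>x\<leftarrow>s. [:- complex_of_real (x\<^sup>2), 1:])"

section \<open>Existence and uniqueness of the list of singular values\<close>

lemma proots_linear_factors: "proots (\<Prod>a\<leftarrow>as. [:- a, 1:]) = mset (as :: 'a :: idom list)"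
proof (induction as)
  case (Cons a as)
  have "(\<Prod>a\<leftarrow>as. [:- a, 1:]) \<noteq> 0" by (auto simp: prod_list_zero_iff)
  thus ?case using Cons by (simp add: proots_mult del: mult_pCons_left)
qed simp

text \<open>Square roots undo the squaring on nonnegative entries, and sorting restores the given
  order. Hence a sorted nonnegative list is determined by its polynomial, also when it is padded
  with zeros.\<close>

lemma proots_square_factors:
  assumes "sorted (rev s)" "\<forall>x\<in>set s. 0 \<le> x"
  shows "rev (sorted_list_of_multiset (image_mset (\<lambda>z. sqrt (Re z))
           (proots (\<Prod>x\<leftarrow>s. [:- complex_of_real (x\<^sup>2), 1:])))) = s"
proof -
  have "proots (\<Prod>x\<leftarrow>s. [:- complex_of_real (x\<^sup>2), 1:]) = mset (map (\<lambda>x. complex_of_real (x\<^sup>2)) s)"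
    using proots_linear_factors[of "map (\<lambda>x. complex_of_real (x\<^sup>2)) s"] by (simp add: o_def)
  hence "image_mset (\<lambda>z. sqrt (Re z)) (proots (\<Prod>x\<leftarrow>s. [:- complex_of_real (x\<^sup>2), 1:]))
    = mset (map (\<lambda>z. sqrt (Re z)) (map (\<lambda>x. complex_of_real (x\<^sup>2)) s))"
    by (simp only: mset_map)
  also have "map (\<lambda>z. sqrt (Re z)) (map (\<lambda>x. complex_of_real (x\<^sup>2)) s) = s"
    using assms by (auto simp: o_def intro!: map_idI)
  finally have "rev (sorted_list_of_multiset (image_mset (\<lambda>z. sqrt (Re z))
      (proots (\<Prod>x\<leftarrow>s. [:- complex_of_real (x\<^sup>2), 1:])))) = rev (sort s)"
        by simp
  also have "rev (sort s) = s"
    using assms(1) by (metis mset_rev properties_for_sort rev_rev_ident)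
  finally show ?thesis .
qed

lemma is_sing_list_unique: "is_sing_list A s \<Longrightarrow> sing_list A = s"
  using proots_square_factors[of s] unfolding sing_list_def is_sing_list_def by metis

text \<open>Degree count: the Gram matrix has size c, so its characteristic polynomial has c linear
  factors.\<close>

lemma is_sing_list_length:
  assumes A: "A \<in> carrier_mat r c" and s: "is_sing_list A s"
  shows "length s = c"
proof -
  have "degree (char_poly (mat_adjoint A * A)) = c"
    using degree_monic_char_poly[OF gram_carrier[OF A]] by simp
  moreover have "char_poly (mat_adjoint A * A) = (\<Prod>a\<leftarrow>map (\<lambda>x. complex_of_real (x\<^sup>2)) s. [:- a, 1:])"
    using s by (simp add: is_sing_list_def o_def)
  ultimately show ?thesis using degree_linear_factors[of uminus "map (\<lambda>x. complex_of_real (x\<^sup>2)) s"] by simp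
qed

text \<open>Over the complex numbers the characteristic polynomial splits. Its roots are eigenvalues
  of a Gram matrix, hence real and nonnegative, so their sorted square roots form a certified
  list.\<close>

lemma is_sing_list_sing_list:
  assumes A: "A \<in> carrier_mat r c"
  shows "is_sing_list A (sing_list A)"
proof -
  let ?G = "mat_adjoint A * A"
  have G: "?G \<in> carrier_mat c c" using A by simp
  from char_poly_factorized[OF G] obtain as where as: "char_poly ?G = (\<Prod>a\<leftarrow>as. [:- a, 1:])"
    by blast
  have re: "complex_of_real (Re a) = a" "0 \<le> Re a" if "a \<in> set as" for a
  proof -
    have "poly (char_poly ?G) a = 0" using that unfolding as poly_prod_list by (force simp: prod_list_zero_iff)
    hence "eigenvalue ?G a" using eigenvalue_root_char_poly[OF G] by simp
    thus "complex_of_real (Re a) = a" "0 \<le> Re a" using eigenvalue_gram_nonneg[OF A] by metis+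
  qed
  define u where "u = map (\<lambda>a. sqrt (Re a)) as"
  define s where "s = rev (sort u)"
  have "is_sing_list A s"
    unfolding is_sing_list_def
  proof (intro conjI)
    show "sorted (rev s)" by (simp add: s_def)
    show "\<forall>x\<in>set s. 0 \<le> x" using re by (auto simp: s_def u_def)
    \<comment> \<open>Sorting only permutes the linear factors, so their product is
      unchanged.\<close>
    have "mset (map (\<lambda>x. [:- complex_of_real (x\<^sup>2), 1:]) s) = mset (map (\<lambda>x. [:- complex_of_real (x\<^sup>2), 1:]) u)"
      by (simp add: s_def)
    hence "(\<Prod>x\<leftarrow>s. [:- complex_of_real (x\<^sup>2), 1:]) = (\<Prod>x\<leftarrow>u. [:- complex_of_real (x\<^sup>2), 1:])"
      unfolding prod_mset_prod_list[symmetric] by (rule arg_cong)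
    also have "map (\<lambda>x. [:- complex_of_real (x\<^sup>2), 1:]) u = map (\<lambda>a. [:- a, 1:]) as"
      using re by (simp add: u_def flip: of_real_power)
    finally show "char_poly ?G = (\<Prod>x\<leftarrow>s. [:- complex_of_real (x\<^sup>2), 1:])"
      using as by simp
  qed
  thus ?thesis using is_sing_list_unique by simp
qed

lemma length_sing_list: "A \<in> carrier_mat r c \<Longrightarrow> length (sing_list A) = c"
  using is_sing_list_length is_sing_list_sing_list by blast

text \<open>The Gram matrix is zero, hence triangular, and its characteristic polynomial is read off
  the diagonal. Needed because zero vectors serve as padding in decompositions.\<close>

lemma sing_list_zero: "sing_list (0\<^sub>m r c) = replicate c 0"
proof (rule is_sing_list_unique)
  have G: "mat_adjoint (0\<^sub>m r c) * 0\<^sub>m r c = (0\<^sub>m c c :: complex mat)"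
    using mat_adjoint_carrier[OF zero_carrier_mat[of r c]] by (rule right_mult_zero_mat)
  have d: "diag_mat (0\<^sub>m c c :: complex mat) = replicate c 0"
    by (auto simp: diag_mat_def intro!: nth_equalityI)
  have "char_poly (0\<^sub>m c c :: complex mat) = (\<Prod>a\<leftarrow>replicate c 0. [:- a, 1:])"
    using char_poly_upper_triangular[of "0\<^sub>m c c :: complex mat" c] by (simp only: d) auto
  thus "is_sing_list (0\<^sub>m r c) (replicate c 0)" by (auto simp: is_sing_list_def G)
qed

lemma poly_gram_char_poly:
  assumes A: "A \<in> carrier_mat r c"
  shows "poly (char_poly (mat_adjoint A * A)) z = (\<Prod>x\<leftarrow>sing_list A. z - complex_of_real (x\<^sup>2))"
  using is_sing_list_sing_list[OF A] by (simp add: is_sing_list_def poly_prod_list o_def)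

section \<open>Scaling of singular values\<close>

lemma prod_list_scale:
  fixes a :: "'a :: field"
  assumes "a \<noteq> 0"
  shows "a ^ length s * (\<Prod>x\<leftarrow>s. z / a - f x) = (\<Prod>x\<leftarrow>s. z - a * f x)"
  by (induction s) (use assms in \<open>auto simp: field_simps\<close>)

lemma gram_smult:
  assumes A: "A \<in> carrier_mat r n"
  shows "mat_adjoint (complex_of_real c \<cdot>\<^sub>m A) * (complex_of_real c \<cdot>\<^sub>m A)
    = complex_of_real (c\<^sup>2) \<cdot>\<^sub>m (mat_adjoint A * A)" (is "?L = ?C \<cdot>\<^sub>m ?G")
proof (rule eq_matI)
  have G: "?G \<in> carrier_mat n n" using A by simp
  fix i j assume "i < dim_row (?C \<cdot>\<^sub>m ?G)" "j < dim_col (?C \<cdot>\<^sub>m ?G)"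
  hence ij: "i < n" "j < n" using G by auto
  have cA: "complex_of_real c \<cdot>\<^sub>m A \<in> carrier_mat r n" using A by simp
  have "(?C \<cdot>\<^sub>m ?G) $$ (i, j) = ?C * ?G $$ (i, j)"
    using G ij by (auto simp del: index_mult_mat)
  then show "?L $$ (i, j) = (?C \<cdot>\<^sub>m ?G) $$ (i, j)"
    unfolding gram_index[OF cA ij] using gram_index[OF A ij] A ij
    by (auto simp: sum_distrib_left power2_eq_square algebra_simps intro!: sum.cong)
qed (use A in \<open>auto simp: mat_adjoint_def\<close>)

text \<open>The Gram matrix is multiplied by c^2, so each root x^2 of its characteristic polynomial
  becomes the square of c x; positivity of c preserves order and sign.\<close>

lemma sing_list_smult:
  assumes A: "A \<in> carrier_mat r n" and c: "0 < c"
  shows "sing_list (complex_of_real c \<cdot>\<^sub>m A) = map ((*) c) (sing_list A)"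
proof (rule is_sing_list_unique)
  let ?G = "mat_adjoint A * A"
  let ?C = "complex_of_real (c\<^sup>2)"
  let ?s = "sing_list A"
  have G: "?G \<in> carrier_mat n n" using A by simp
  have C0: "?C \<noteq> 0" using c by simp
  have "char_poly (?C \<cdot>\<^sub>m ?G) = (\<Prod>x\<leftarrow>map ((*) c) ?s. [:- complex_of_real (x\<^sup>2), 1:])"
  proof (rule poly_ext)
    fix z
    have CG: "?C \<cdot>\<^sub>m ?G \<in> carrier_mat n n" using G by simp
    \<comment> \<open>Pulling the scalar out of the whole matrix makes the determinant contribute
      the factor \<open>?C ^ n\<close>.\<close>
    have "z \<cdot>\<^sub>m 1\<^sub>m n - ?C \<cdot>\<^sub>m H = ?C \<cdot>\<^sub>m (z / ?C \<cdot>\<^sub>m 1\<^sub>m n - H)"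
      if "H \<in> carrier_mat n n" for H
      using that c by (intro eq_matI) (auto simp: right_diff_distrib)
    from this[OF G]
    have "poly (char_poly (?C \<cdot>\<^sub>m ?G)) z = ?C ^ n * poly (char_poly ?G) (z / ?C)"
      using poly_char_poly[OF CG, of z] poly_char_poly[OF G, of "z / ?C"] G A by (simp add: carrier_matD[OF A])
    also have "\<dots> = (\<Prod>x\<leftarrow>?s. z - ?C * complex_of_real (x\<^sup>2))"
      using prod_list_scale[OF C0, of ?s z "\<lambda>x. complex_of_real (x\<^sup>2)"]
      by (simp only: poly_gram_char_poly[OF A] length_sing_list[OF A])
    finally show "poly (char_poly (?C \<cdot>\<^sub>m ?G)) z = poly (\<Prod>x\<leftarrow>map ((*) c) ?s. [:- complex_of_real (x\<^sup>2), 1:]) z"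
      by (simp add: poly_prod_list o_def power_mult_distrib)
  qed
  moreover have "sorted (rev (map ((*) c) ?s))"
    using is_sing_list_sing_list[OF A] c
    by (auto simp: is_sing_list_def rev_map sorted_map intro: sorted_wrt_mono_rel[rotated])
  ultimately show "is_sing_list (complex_of_real c \<cdot>\<^sub>m A) (map ((*) c) ?s)"
    using is_sing_list_sing_list[OF A] c by (auto simp: is_sing_list_def gram_smult[OF A])
qed

lemma sing_val_smult:
  assumes "A \<in> carrier_mat r n" "0 < c"
  shows "sing_val (complex_of_real c \<cdot>\<^sub>m A) j = c * sing_val A j"
  using sing_list_smult[OF assms] by (auto simp: sing_val_def)

lemma sing_val_zero: "sing_val (0\<^sub>m r c) j = 0"
  by (auto simp: sing_val_def sing_list_zero)

text \<open>Both sides compute the determinant of the block matrix \<open>[zI, A; B, I]\<close>, multiplied by a block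
  triangular matrix from the right and from the left respectively.\<close>

lemma det_minus_mult_swap:
  fixes A B :: "'a :: idom mat"
  assumes A: "A \<in> carrier_mat r n" and B: "B \<in> carrier_mat n r"
  shows "z ^ n * det (z \<cdot>\<^sub>m 1\<^sub>m r - A * B) = z ^ r * det (z \<cdot>\<^sub>m 1\<^sub>m n - B * A)"
proof -
  define M where "M = four_block_mat (z \<cdot>\<^sub>m 1\<^sub>m r) A B (1\<^sub>m n)"
  define N where "N = four_block_mat (1\<^sub>m r) (0\<^sub>m r n) (- B) (1\<^sub>m n)"
  define L where "L = four_block_mat (1\<^sub>m r) (0\<^sub>m r n) (- B) (z \<cdot>\<^sub>m 1\<^sub>m n)"
  have M: "M \<in> carrier_mat (r + n) (r + n)" and N: "N \<in> carrier_mat (r + n) (r + n)"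
    and L: "L \<in> carrier_mat (r + n) (r + n)"
    using A B by (auto simp: M_def N_def L_def)
  have "M * N = four_block_mat (z \<cdot>\<^sub>m 1\<^sub>m r * 1\<^sub>m r + A * - B) (z \<cdot>\<^sub>m 1\<^sub>m r * 0\<^sub>m r n + A * 1\<^sub>m n)
      (B * 1\<^sub>m r + 1\<^sub>m n * - B) (B * 0\<^sub>m r n + 1\<^sub>m n * 1\<^sub>m n)"
    unfolding M_def N_def by (rule mult_four_block_mat) (use A B in auto)
  also have "\<dots> = four_block_mat (z \<cdot>\<^sub>m 1\<^sub>m r - A * B) A (0\<^sub>m n r) (1\<^sub>m n)"
    using A B by (intro cong_four_block_mat) (auto intro!: eq_matI)
  finally have MN: "det (M * N) = det (z \<cdot>\<^sub>m 1\<^sub>m r - A * B)"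
    using A B by (simp only:) (subst det_four_block_mat_lower_left_zero[of _ r _ n]; auto)
  have "L * M = four_block_mat (1\<^sub>m r * (z \<cdot>\<^sub>m 1\<^sub>m r) + 0\<^sub>m r n * B) (1\<^sub>m r * A + 0\<^sub>m r n * 1\<^sub>m n)
      (- B * (z \<cdot>\<^sub>m 1\<^sub>m r) + z \<cdot>\<^sub>m 1\<^sub>m n * B) (- B * A + z \<cdot>\<^sub>m 1\<^sub>m n * 1\<^sub>m n)"
    unfolding M_def L_def by (rule mult_four_block_mat) (use A B in auto)
  also have "\<dots> = four_block_mat (z \<cdot>\<^sub>m 1\<^sub>m r) A (0\<^sub>m n r) (z \<cdot>\<^sub>m 1\<^sub>m n - B * A)"
    using A B by (intro cong_four_block_mat) (auto intro!: eq_matI)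
  finally have LM: "det (L * M) = z ^ r * det (z \<cdot>\<^sub>m 1\<^sub>m n - B * A)"
    using A B by (simp only:) (subst det_four_block_mat_lower_left_zero[of _ r _ n]; auto)
  have "det N = 1" using B
    unfolding N_def by (subst det_four_block_mat_upper_right_zero[of _ r _ n]) auto
  moreover have "det L = z ^ n" using B
    unfolding L_def by (subst det_four_block_mat_upper_right_zero[of _ r _ n]) auto
  ultimately show ?thesis
    using MN LM det_mult[OF M N] det_mult[OF L M] by (simp add: mult_ac)
qed

lemma gram_transpose:
  fixes A :: "complex mat"
  assumes A: "A \<in> carrier_mat r c"
  shows "mat_adjoint (transpose_mat A) * transpose_mat A = transpose_mat (A * mat_adjoint A)"
proof -
  have "mat_adjoint (transpose_mat A) = transpose_mat (mat_adjoint A)"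
    using A by (intro eq_matI) (auto simp: mat_adjoint_index[of _ c r] mat_adjoint_index[of _ r c] mat_adjoint_def mat_of_rows_def)
  thus ?thesis using A transpose_mult[OF A mat_adjoint_carrier[OF A]] by simp
qed

text \<open>The Gram matrix of the transpose is the transpose of A A^*, and A A^* has the same
  characteristic polynomial as A^* A up to powers of z. The two lists thus differ only in trailing
  zeros.\<close>

lemma sing_val_transpose:
  assumes A: "A \<in> carrier_mat r c"
  shows "sing_val (transpose_mat A) = sing_val A"
proof -
  have AT: "transpose_mat A \<in> carrier_mat c r" using A by simp
  let ?s = "sing_list A" and ?t = "sing_list (transpose_mat A)"
  let ?p = "\<lambda>s. \<Prod>x\<leftarrow>s. [:- complex_of_real (x\<^sup>2), 1:]"
  have s: "is_sing_list A ?s" and t: "is_sing_list (transpose_mat A) ?t"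
    using is_sing_list_sing_list A AT by blast+
  have AA: "A * mat_adjoint A \<in> carrier_mat r r"
    using A mat_adjoint_carrier[OF A] by (metis mult_carrier_mat)
  \<comment> \<open>Both padded lists have length r + c; the added zeros account for the powers of z
    in the determinant identity.\<close>
  have "?p (?t @ replicate c 0) = ?p (?s @ replicate r 0)"
  proof (rule poly_ext)
    fix z :: complex
    have "z ^ c * poly (char_poly (A * mat_adjoint A)) z = z ^ r * poly (char_poly (mat_adjoint A * A)) z"
      unfolding poly_char_poly[OF AA] poly_char_poly[OF gram_carrier[OF A]]
      by (rule det_minus_mult_swap[OF A mat_adjoint_carrier[OF A]])
    moreover have "char_poly (A * mat_adjoint A) = ?p ?t"
      using t char_poly_transpose_mat[OF AA] by (simp add: is_sing_list_def gram_transpose[OF A])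
    moreover have "char_poly (mat_adjoint A * A) = ?p ?s"
      using s by (simp add: is_sing_list_def)
    ultimately show "poly (?p (?t @ replicate c 0)) z = poly (?p (?s @ replicate r 0)) z"
      by (simp add: poly_prod_list o_def map_replicate_const prod_list_replicate mult.commute)
  qed
  moreover have "sorted (rev (?t @ replicate c 0))" "sorted (rev (?s @ replicate r 0))"
    "\<forall>x\<in>set (?t @ replicate c 0). 0 \<le> x"
      "\<forall>x\<in>set (?s @ replicate r 0). 0 \<le> x"
    using s t by (auto simp: is_sing_list_def sorted_append)
  ultimately have eq: "?t @ replicate c 0 = ?s @ replicate r 0"
    by (metis proots_square_factors)
  \<comment> \<open>\<open>sing_val\<close> is 0 beyond the end of the list, so appended zeros do
    not alter it.\<close>
  have "sing_val B j = (if 1 \<le> j \<and> j \<le> length (sing_list B @ replicate k 0)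
    then (sing_list B @ replicate k 0) ! (j - 1) else 0)" for B j k
    by (auto simp: sing_val_def nth_append)
  from this[of "transpose_mat A" _ c] this[of A _ r] eq show ?thesis by (simp add: fun_eq_iff)
qed

section \<open>Continuity of singular values\<close>

lemma tendsto_det:
  fixes M :: "nat \<Rightarrow> complex mat"
  assumes "\<And>l. M l \<in> carrier_mat n n" "M0 \<in> carrier_mat n n"
    and "\<And>i j. i < n \<Longrightarrow> j < n \<Longrightarrow> (\<lambda>l. M l $$ (i, j)) \<longlonglongrightarrow> M0 $$ (i, j)"
  shows "(\<lambda>l. det (M l)) \<longlonglongrightarrow> det M0"
proof -
  have "(\<lambda>l. \<Sum>p\<in>{p. p permutes {0..<n}}. signof p * (\<Prod>i = 0..<n. M l $$ (i, p i))) \<longlonglongrightarrow>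
    (\<Sum>p\<in>{p. p permutes {0..<n}}. signof p * (\<Prod>i = 0..<n. M0 $$ (i, p i)))"
    by (intro tendsto_sum tendsto_mult tendsto_const tendsto_prod assms)
      (auto dest: permutes_in_image[THEN iffD2])
  thus ?thesis unfolding det_def'[OF assms(1)] det_def'[OF assms(2)] .
qed

text \<open>By the Leibniz formula each value is a polynomial in the entries of A and their
  conjugates.\<close>

lemma tendsto_poly_gram:
  fixes A :: "nat \<Rightarrow> complex mat"
  assumes A: "\<And>l. A l \<in> carrier_mat r c" and A0: "A0 \<in> carrier_mat r c"
    and lim: "\<And>i j. i < r \<Longrightarrow> j < c \<Longrightarrow> (\<lambda>l. A l $$ (i, j)) \<longlonglongrightarrow> A0 $$ (i, j)"
  shows "(\<lambda>l. poly (char_poly (mat_adjoint (A l) * A l)) z) \<longlonglongrightarrow> poly (char_poly (mat_adjoint A0 * A0)) z"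
  unfolding poly_char_poly[OF gram_carrier[OF A]] poly_char_poly[OF gram_carrier[OF A0]]
proof (rule tendsto_det[where n = c])
  fix i j assume ij: "i < c" "j < c"
  have ind: "(z \<cdot>\<^sub>m 1\<^sub>m c - mat_adjoint B * B) $$ (i, j)
    = (if i = j then z else 0) - (\<Sum>l<r. cnj (B $$ (l, i)) * B $$ (l, j))"
      if "B \<in> carrier_mat r c" for B
  proof -
    have "(z \<cdot>\<^sub>m 1\<^sub>m c - G) $$ (i, j) = (if i = j then z else 0) - G $$ (i, j)"
      if "G \<in> carrier_mat c c" for G
      using that ij by auto
    from this[OF gram_carrier[OF that]] show ?thesis using gram_index[OF that ij] by simp
  qed
  show "(\<lambda>l. (z \<cdot>\<^sub>m 1\<^sub>m c - mat_adjoint (A l) * A l) $$ (i, j)) \<longlonglongrightarrow> (z \<cdot>\<^sub>m 1\<^sub>m c - mat_adjoint A0 * A0) $$ (i, j)"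
    unfolding ind[OF A] ind[OF A0] using ij
    by (intro tendsto_diff tendsto_const tendsto_sum tendsto_mult tendsto_cnj lim) auto
qed (auto intro!: minus_carrier_mat gram_carrier A A0)

lemma sing_val_nonneg:
  assumes "A \<in> carrier_mat r c"
  shows "0 \<le> sing_val A j"
  using is_sing_list_sing_list[OF assms] by (auto simp: sing_val_def is_sing_list_def)

text \<open>At \<open>z = -1\<close> the characteristic polynomial of \<open>A\<^sup>*A\<close> is, up to sign, the product of all
  \<open>1 + \<sigma>\<^sub>i\<^sup>2\<close>, which dominates each single singular value.\<close>

lemma sing_val_le_cmod_poly:
  assumes A: "A \<in> carrier_mat r c"
  shows "sing_val A j \<le> cmod (poly (char_poly (mat_adjoint A * A)) (- 1))"
proof -
  have eq: "cmod (poly (char_poly (mat_adjoint A * A)) (- 1)) = (\<Prod>x\<leftarrow>sing_list A. 1 + x\<^sup>2)"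
  proof -
    have "cmod (\<Prod>x\<leftarrow>s. - 1 - complex_of_real (x\<^sup>2)) = (\<Prod>x\<leftarrow>s. 1 + x\<^sup>2)" for s
    proof (induction s)
      case (Cons x s)
      have "- 1 - complex_of_real (x\<^sup>2) = complex_of_real (- (1 + x\<^sup>2))" by simp
      hence "cmod (- 1 - complex_of_real (x\<^sup>2)) = 1 + x\<^sup>2" 
        by (metis abs_minus_cancel abs_of_nonneg add_nonneg_nonneg norm_of_real zero_le_one zero_le_power2)
      thus ?case using Cons by (simp only: list.map prod_list.Cons norm_mult)
    qed simp
    thus ?thesis by (simp only: poly_gram_char_poly[OF A])
  qed
  have ge1: "1 \<le> (\<Prod>x\<leftarrow>s. 1 + x\<^sup>2)" for s :: "real list"
    by (induction s) (auto intro: mult_mono[of 1 _ 1, simplified] order_trans[OF _ mult_mono[of 1 _ 1]])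
  have mem: "x \<le> (\<Prod>x\<leftarrow>s. 1 + x\<^sup>2)"
    if "x \<in> set s" for s :: "real list" and x
    using that
  proof (induction s)
    case (Cons y s)
    show ?case
    proof (cases "x = y")
      case True
      have "2 * x \<le> 1 + x\<^sup>2" using zero_le_power2[of "x - 1"] by (simp add: power2_eq_square algebra_simps)
      hence "x \<le> 1 + x\<^sup>2" by (smt (verit) zero_le_power2)
      also have "\<dots> \<le> (1 + x\<^sup>2) * (\<Prod>x\<leftarrow>s. 1 + x\<^sup>2)"
        using mult_left_mono[OF ge1[of s], of "1 + x\<^sup>2"] by simp
      finally show ?thesis using True by simp
    next
      case False
      hence "x \<le> (\<Prod>x\<leftarrow>s. 1 + x\<^sup>2)" using Cons by simp
      also have "\<dots> \<le> (1 + y\<^sup>2) * (\<Prod>x\<leftarrow>s. 1 + x\<^sup>2)"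
        using ge1[of s] by (simp add: algebra_simps)
      finally show ?thesis by simp
    qed
  qed simp
  show ?thesis
    using mem ge1[of "sing_list A"] unfolding eq sing_val_def by (auto intro: order_trans[of 0 1])
qed

text \<open>Convergence of the singular values is a hypothesis because compactness supplies it along a
  subsequence; their limits are then identified by comparing characteristic polynomials.\<close>

lemma sing_val_limit:
  assumes A: "\<And>l. A l \<in> carrier_mat r c" and A0: "A0 \<in> carrier_mat r c"
    and lim: "\<And>i j. i < r \<Longrightarrow> j < c \<Longrightarrow> (\<lambda>l. A l $$ (i, j)) \<longlonglongrightarrow> A0 $$ (i, j)"
    and s: "\<And>j. 1 \<le> j \<Longrightarrow> j \<le> c \<Longrightarrow> (\<lambda>l. sing_val (A l) j) \<longlonglongrightarrow> s j"
  shows "(\<lambda>l. sing_val (A l) j) \<longlonglongrightarrow> sing_val A0 j"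
proof -
  let ?u = "map s [1..<Suc c]"
  have nth: "sing_val B (Suc i) = sing_list B ! i" if "B \<in> carrier_mat r c" "i < c" for B i
    using length_sing_list[OF that(1)] that(2) by (simp add: sing_val_def)
  have lim_i: "(\<lambda>l. sing_list (A l) ! i) \<longlonglongrightarrow> s (Suc i)"
    if "i < c" for i
    using s[of "Suc i"] nth[OF A that] that by simp
  have isl: "is_sing_list (A l) (sing_list (A l))" for l using is_sing_list_sing_list[OF A] .
  \<comment> \<open>Order and sign are weak inequalities and survive the limit. The factorization
    follows by computing the limit of the same products twice: as characteristic polynomials and
    factor by factor.\<close>
  have "is_sing_list A0 ?u"
    unfolding is_sing_list_def
  proof (intro conjI)
    have "s (Suc j) \<le> s (Suc i)" if ij: "i \<le> j" "j < c" for i j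
    proof (rule LIMSEQ_le[OF lim_i lim_i])
      show "\<exists>N. \<forall>l\<ge>N. sing_list (A l) ! j \<le> sing_list (A l) ! i"
        using ij isl length_sing_list[OF A] by (auto simp: is_sing_list_def sorted_rev_iff_nth_mono)
    qed (use ij in auto)
    thus "sorted (rev ?u)" by (auto simp: sorted_rev_iff_nth_mono simp del: upt_Suc)
    have "0 \<le> s (Suc i)" if "i < c" for i
    proof (rule LIMSEQ_le_const[OF lim_i[OF that]])
      show "\<exists>N. \<forall>l\<ge>N. 0 \<le> sing_list (A l) ! i"
        using that isl length_sing_list[OF A] unfolding is_sing_list_def by (metis nth_mem)
    qed
    hence "0 \<le> s j" if "1 \<le> j" "j \<le> c" for j
      using that by (metis One_nat_def Suc_le_D Suc_le_lessD)
    thus "\<forall>x\<in>set ?u. 0 \<le> x" by (auto simp del: upt_Suc)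
    show "char_poly (mat_adjoint A0 * A0) = (\<Prod>x\<leftarrow>?u. [:- complex_of_real (x\<^sup>2), 1:])"
    proof (rule poly_ext)
      fix z
      have "(\<Prod>x\<leftarrow>sing_list (A l). z - complex_of_real (x\<^sup>2)) = (\<Prod>i<c. z - complex_of_real ((sing_list (A l) ! i)\<^sup>2))" for l
        using length_sing_list[OF A] by (simp add: prod.list_conv_set_nth lessThan_atLeast0)
      hence 1: "(\<lambda>l. \<Prod>i<c. z - complex_of_real ((sing_list (A l) ! i)\<^sup>2)) \<longlonglongrightarrow> poly (char_poly (mat_adjoint A0 * A0)) z"
        using tendsto_poly_gram[OF A A0 lim, of z] by (simp only: poly_gram_char_poly[OF A])
      have 2: "(\<lambda>l. \<Prod>i<c. z - complex_of_real ((sing_list (A l) ! i)\<^sup>2)) \<longlonglongrightarrow> (\<Prod>i<c. z - complex_of_real ((s (Suc i))\<^sup>2))"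
        by (intro tendsto_prod tendsto_diff tendsto_const tendsto_of_real tendsto_power lim_i) auto
      have "poly (\<Prod>x\<leftarrow>?u. [:- complex_of_real (x\<^sup>2), 1:]) z = (\<Prod>i<c. z - complex_of_real ((s (Suc i))\<^sup>2))"
        by (simp add: poly_prod_list poly_prod o_def prod.list_conv_set_nth lessThan_atLeast0 del: upt_Suc)
      thus "poly (char_poly (mat_adjoint A0 * A0)) z = poly (\<Prod>x\<leftarrow>?u. [:- complex_of_real (x\<^sup>2), 1:]) z"
        using LIMSEQ_unique[OF 1 2] by simp
    qed
  qed
  from is_sing_list_unique[OF this] have "sing_val A0 j = s j" if "1 \<le> j" "j \<le> c" for j
    using that by (auto simp: sing_val_def simp del: upt_Suc)
  \<comment> \<open>Outside the range 1 to c, where the hypothesis on \<open>s\<close> is silent,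
    every value is 0 by default.\<close>
  moreover have "sing_val B j = 0" if "\<not> (1 \<le> j \<and> j \<le> c)"
    "B \<in> carrier_mat r c" for B
    using that length_sing_list by (auto simp: sing_val_def)
  ultimately show ?thesis using s A A0 by (cases "1 \<le> j \<and> j \<le> c") auto
qed

subsection \<open>Conic combinations and subsequences\<close>

text \<open>Gaussian elimination: a homogeneous system with more unknowns than equations has a
  nontrivial solution. Each step uses up one equation and one pivot unknown.\<close>

lemma linear_dependence_exists:
  fixes v :: "'i \<Rightarrow> 'j \<Rightarrow> 'a :: field"
  assumes "finite J" "finite I" "card J < card I"
  shows "\<exists>c. (\<exists>i\<in>I. c i \<noteq> 0) \<and> (\<forall>j\<in>J. (\<Sum>i\<in>I. c i * v i j) = 0)"
  using assms
proof (induction J arbitrary: I v rule: finite_induct)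
  case empty
  then obtain i where "i \<in> I" by (metis card.empty equals0I less_irrefl)
  thus ?case by (intro exI[of _ "\<lambda>_. 1"]) auto
next
  case (insert j0 J)
  show ?case
  proof (cases "\<exists>k\<in>I. v k j0 \<noteq> 0")
    case False
    have "card J < card I" using insert by simp
    from insert.IH[OF insert.prems(1) this, of v] False show ?thesis by (auto intro!: sum.neutral)
  next
    case True
    then obtain k where k: "k \<in> I" "v k j0 \<noteq> 0" by blast
    \<comment> \<open>Coefficients after subtracting the multiple of row \<open>k\<close> that kills
      column \<open>j0\<close>.\<close>
    define w where "w i j = v i j - v i j0 / v k j0 * v k j" for i j
    have "card J < card (I - {k})" using insert k by (simp add: card_insert_if)
    from insert.IH[OF _ this, of w] insert.prems obtain c where
      c: "\<exists>i\<in>I - {k}. c i \<noteq> 0"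
        "\<And>j. j \<in> J \<Longrightarrow> (\<Sum>i\<in>I - {k}. c i * w i j) = 0"
        by auto
    \<comment> \<open>The coefficient at the pivot is solved from equation
      \<open>j0\<close>.\<close>
    define d where "d = c(k := - (\<Sum>i\<in>I - {k}. c i * v i j0) / v k j0)"
    have sum_d: "(\<Sum>i\<in>I. d i * v i j) = (\<Sum>i\<in>I - {k}. c i * w i j)" for j
    proof -
      have "(\<Sum>i\<in>I. d i * v i j) = d k * v k j + (\<Sum>i\<in>I - {k}. d i * v i j)"
        using insert.prems k by (simp add: sum.remove)
      also have "(\<Sum>i\<in>I - {k}. d i * v i j) = (\<Sum>i\<in>I - {k}. c i * v i j)"
        by (intro sum.cong) (auto simp: d_def)
      also have "d k * v k j = - (\<Sum>i\<in>I - {k}. c i * (v i j0 / v k j0 * v k j))"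
        by (simp add: d_def sum_divide_distrib sum_distrib_right mult.assoc)
      finally show ?thesis by (simp add: w_def algebra_simps sum_subtractf)
    qed
    have "w i j0 = 0" for i using k by (simp add: w_def)
    hence "\<forall>j\<in>insert j0 J. (\<Sum>i\<in>I. d i * v i j) = 0"
      using c(2) by (simp add: sum_d)
    moreover have "\<exists>i\<in>I. d i \<noteq> 0" using c(1) by (auto simp: d_def)
    ultimately show ?thesis by blast
  qed
qed

text \<open>While there are more vectors than coordinates, a linear dependence can be subtracted
  until some weight reaches zero. For cones the bound is the dimension itself, without an added
  1.\<close>

lemma conic_caratheodory:
  fixes v :: "'i \<Rightarrow> 'j \<Rightarrow> real"
  assumes "finite J" "finite I" "\<And>i. i \<in> I \<Longrightarrow> 0 < t i"
  shows "\<exists>I' t'. I' \<subseteq> I \<and> card I' \<le> card J \<and> (\<forall>i\<in>I'. 0 < t' i) \<and>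
           (\<forall>j\<in>J. (\<Sum>i\<in>I'. t' i * v i j) = (\<Sum>i\<in>I. t i * v i j))"
  using assms(2,3)
proof (induction "card I" arbitrary: I t rule: less_induct)
  case less
  show ?case
  proof (cases "card I \<le> card J")
    case True
    thus ?thesis using less.prems by blast
  next
    case False
    with linear_dependence_exists[OF assms(1) less.prems(1), of v]
    obtain c0 where c0: "\<exists>i\<in>I. c0 i \<noteq> 0"
      "\<forall>j\<in>J. (\<Sum>i\<in>I. c0 i * v i j) = 0"
      by auto
    \<comment> \<open>Negating the dependence if necessary gives a positive coefficient, so that
      moving against it decreases some weight.\<close>
    have "\<exists>c. (\<exists>i\<in>I. c i > 0) \<and> (\<forall>j\<in>J. (\<Sum>i\<in>I. c i * v i j) = 0)"
    proof (cases "\<exists>i\<in>I. c0 i > 0")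
      case False
      hence "\<exists>i\<in>I. - c0 i > 0" using c0 by force
      moreover have "\<forall>j\<in>J. (\<Sum>i\<in>I. - c0 i * v i j) = 0"
        using c0 by (simp add: sum_negf)
      ultimately show ?thesis by (intro exI[of _ "\<lambda>i. - c0 i"] conjI)
    qed (use c0 in blast)
    then obtain c where c: "\<exists>i\<in>I. c i > 0"
      "\<And>j. j \<in> J \<Longrightarrow> (\<Sum>i\<in>I. c i * v i j) = 0"
      by blast
    define P where "P = {i\<in>I. c i > 0}"
    have P: "finite P" "P \<noteq> {}" using less.prems c by (auto simp: P_def)
    \<comment> \<open>The minimal ratio is the largest step that keeps all weights nonnegative; the
      weight at \<open>k\<close> then vanishes.\<close>
    define k where "k = arg_min_on (\<lambda>i. t i / c i) P"
    have k: "k \<in> P" "\<And>i. i \<in> P \<Longrightarrow> t k / c k \<le> t i / c i"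
      unfolding k_def using arg_min_if_finite(1)[OF P] arg_min_least[OF P] by auto
    define l where "l = t k / c k"
    define t' where "t' i = t i - l * c i" for i
    have l: "l > 0" using k less.prems by (auto simp: l_def P_def)
    have t'0: "t' i \<ge> 0" if "i \<in> I" for i
    proof (cases "c i > 0")
      case True
      thus ?thesis using k(2)[of i] that by (simp add: t'_def l_def P_def pos_le_divide_eq)
    next
      case False
      hence "l * c i \<le> 0" using l by (simp add: mult_nonneg_nonpos)
      thus ?thesis using less.prems(2)[OF that] by (simp add: t'_def)
    qed
    have t'k: "t' k = 0" using k by (simp add: t'_def l_def P_def)
    define I2 where "I2 = {i\<in>I. t' i \<noteq> 0}"
    have "I2 \<subset> I" using k t'k by (auto simp: I2_def P_def)
    hence card: "card I2 < card I" using less.prems by (simp add: psubset_card_mono)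
    have "finite I2" "\<And>i. i \<in> I2 \<Longrightarrow> 0 < t' i"
      using less.prems t'0 by (auto simp: I2_def less_le)
    from less.hyps[OF card this(1), of t', OF this(2)] obtain I' s where
      I': "I' \<subseteq> I2" "card I' \<le> card J" "\<forall>i\<in>I'. 0 < s i"
        "\<forall>j\<in>J. (\<Sum>i\<in>I'. s i * v i j) = (\<Sum>i\<in>I2. t' i * v i j)" by blast
    have "(\<Sum>i\<in>I2. t' i * v i j) = (\<Sum>i\<in>I. t i * v i j)" if "j \<in> J" for j
    proof -
      have "(\<Sum>i\<in>I2. t' i * v i j) = (\<Sum>i\<in>I. t' i * v i j)"
        using less.prems by (intro sum.mono_neutral_left) (auto simp: I2_def)
      also have "\<dots> = (\<Sum>i\<in>I. t i * v i j) - l * (\<Sum>i\<in>I. c i * v i j)"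
        by (simp add: t'_def algebra_simps sum_subtractf sum_distrib_left)
      finally show ?thesis using c(2)[OF that] by simp
    qed
    with I' \<open>I2 \<subset> I\<close> show ?thesis by (intro exI[of _ I'] exI[of _ s]) auto
  qed
qed

text \<open>Bolzano-Weierstrass for one coordinate at a time, each time refining the previous
  subsequence.\<close>

lemma common_convergent_subseq:
  fixes f :: "'a \<Rightarrow> nat \<Rightarrow> complex"
  assumes "finite S" "\<And>a n. a \<in> S \<Longrightarrow> cmod (f a n) \<le> B a"
  shows "\<exists>r. strict_mono (r :: nat \<Rightarrow> nat) \<and> (\<exists>L. \<forall>a\<in>S. (\<lambda>n. f a (r n)) \<longlonglongrightarrow> L a)"
  using assms
proof (induction S rule: finite_induct)
  case empty
  show ?case by (rule exI[of _ id]) (auto simp: strict_mono_def)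
next
  case (insert b S)
  have "\<exists>r. strict_mono (r :: nat \<Rightarrow> nat) \<and> (\<exists>L. \<forall>a\<in>S. (\<lambda>n. f a (r n)) \<longlonglongrightarrow> L a)"
    using insert.prems by (intro insert.IH) auto
  then obtain r L where rL: "strict_mono r \<and> (\<forall>a\<in>S. (\<lambda>n. f a (r n)) \<longlonglongrightarrow> L a)"
    by (elim exE conjE) (rule that, simp)
  hence r: "strict_mono r" "\<And>a. a \<in> S \<Longrightarrow> (\<lambda>n. f a (r n)) \<longlonglongrightarrow> L a"
    by simp_all
  obtain g z where g: "strict_mono (g :: nat \<Rightarrow> nat)"
      "\<forall>e>0. \<exists>N. \<forall>n\<ge>N. cmod (f b (r (g n)) - z) < e"
    using Bolzano_Weierstrass_complex_disc[of "\<lambda>n. f b (r n)" "B b"] insert.prems by auto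
  have "(\<lambda>n. f b (r (g n))) \<longlonglongrightarrow> z"
    using g(2) by (simp add: LIMSEQ_iff)
  moreover have "(\<lambda>n. f a (r (g n))) \<longlonglongrightarrow> L a" if "a \<in> S" for a
    using LIMSEQ_subseq_LIMSEQ[OF r(2)[OF that] g(1)] by (simp add: o_def)
  moreover have "strict_mono (\<lambda>n. r (g n))"
    using strict_mono_o[OF r(1) g(1)] by (simp add: o_def)
  ultimately show ?case using insert.hyps
    by (intro exI[of _ "\<lambda>n. r (g n)"] conjI exI[of _ "L(b := z)"]) auto
qed

subsection \<open>Admissible vectors and rank-one decompositions\<close>

text \<open>Unlike \<open>V_alpha\<close> this imposes no normalisation, so weights can be absorbed
  and the zero vector is included.\<close>

definition adm_vec :: "nat \<Rightarrow> nat \<Rightarrow> real \<Rightarrow> complex vec \<Rightarrow> bool" where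
  "adm_vec n m \<alpha> \<phi> \<longleftrightarrow> \<phi> \<in> carrier_vec (n * m) \<and> adm_seq \<alpha> (schmidt n m \<phi>)"

text \<open>The number of terms is a parameter because the compactness argument needs one number
  common to a whole sequence.\<close>

definition adm_decomp :: "nat \<Rightarrow> nat \<Rightarrow> real \<Rightarrow> nat \<Rightarrow> complex mat \<Rightarrow> bool" where
  "adm_decomp n m \<alpha> N C \<longleftrightarrow>
     (\<exists>\<phi>. (\<forall>i<N. adm_vec n m \<alpha> (\<phi> i)) \<and> C = msum (n * m) (n * m) (\<lambda>i. proj (\<phi> i)) N)"

text \<open>Both admissibility conditions are homogeneous of degree one.\<close>

lemma adm_seq_scale:
  assumes "adm_seq \<alpha> s" "0 \<le> c"
  shows "adm_seq \<alpha> (\<lambda>j. c * s j)"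
proof -
  have "c * a \<le> b * (\<Sum>j=1..k. c * s j)" if "a \<le> b * (\<Sum>j=1..k. s j)" for a b k
    using mult_left_mono[OF that assms(2)] by (simp add: sum_distrib_left mult_ac)
  thus ?thesis using assms(1) unfolding adm_seq_def Let_def by (metis mult_zero_right)
qed

text \<open>For fixed \<alpha> the conditions are equalities and weak inequalities in finitely many
  terms each, hence closed.\<close>

lemma adm_seq_limit:
  assumes "\<And>l. adm_seq \<alpha> (s l)"
    "\<And>j. (\<lambda>l. s l j) \<longlonglongrightarrow> s0 j"
  shows "adm_seq \<alpha> s0"
proof -
  let ?k = "nat \<lfloor>\<alpha>\<rfloor>" and ?r = "nat \<lceil>\<alpha>\<rceil>"
  have "s0 j = 0" if "?r + 1 \<le> j" for j
  proof -
    have "s l j = 0" for l using assms(1)[of l] that unfolding adm_seq_def Let_def by blast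
    thus ?thesis using assms(2)[of j] by (simp add: LIMSEQ_const_iff)
  qed
  moreover have "s0 (?k + 1) \<le> (\<alpha> - real ?k) / real ?k * (\<Sum>j=1..?k. s0 j)"
    if "\<alpha> - real ?k > 0"
  proof (rule LIMSEQ_le)
    show "(\<lambda>l. s l (?k + 1)) \<longlonglongrightarrow> s0 (?k + 1)" by (rule assms)
    show "(\<lambda>l. (\<alpha> - real ?k) / real ?k * (\<Sum>j=1..?k. s l j)) \<longlonglongrightarrow> (\<alpha> - real ?k) / real ?k * (\<Sum>j=1..?k. s0 j)"
      by (intro tendsto_mult tendsto_const tendsto_sum assms)
    show "\<exists>N. \<forall>l\<ge>N. s l (?k + 1) \<le> (\<alpha> - real ?k) / real ?k * (\<Sum>j=1..?k. s l j)"
      using assms(1) that unfolding adm_seq_def Let_def by blast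
  qed
  ultimately show ?thesis unfolding adm_seq_def Let_def by blast
qed

lemma coef_mat_carrier [simp]: "coef_mat n m \<phi> \<in> carrier_mat n m"
  by (simp add: coef_mat_def)

lemma tensor_index_less: "i < n \<Longrightarrow> j < m \<Longrightarrow> i * m + j < n * (m :: nat)"
proof -
  assume "i < n" "j < m"
  hence "i * m + j < Suc i * m" by simp
  also have "\<dots> \<le> n * m" using \<open>i < n\<close> by (intro mult_right_mono) auto
  finally show ?thesis .
qed

lemma adm_vec_smult:
  assumes "adm_vec n m \<alpha> \<phi>" "0 < c"
  shows "adm_vec n m \<alpha> (complex_of_real c \<cdot>\<^sub>v \<phi>)"
proof -
  have "coef_mat n m (complex_of_real c \<cdot>\<^sub>v \<phi>) = complex_of_real c \<cdot>\<^sub>m coef_mat n m \<phi>"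
    using assms(1) by (intro eq_matI) (auto simp: coef_mat_def adm_vec_def tensor_index_less)
  hence "schmidt n m (complex_of_real c \<cdot>\<^sub>v \<phi>) = (\<lambda>j. c * schmidt n m \<phi> j)"
    using assms(2) by (auto simp: schmidt_def sing_val_smult[OF coef_mat_carrier])
  thus ?thesis using assms adm_seq_scale[of \<alpha> "schmidt n m \<phi>" c] by (simp add: adm_vec_def)
qed

lemma adm_vec_zero: "adm_vec n m \<alpha> (0\<^sub>v (n * m))"
proof -
  have "coef_mat n m (0\<^sub>v (n * m)) = 0\<^sub>m n m"
    by (intro eq_matI) (auto simp: coef_mat_def tensor_index_less)
  hence "schmidt n m (0\<^sub>v (n * m)) = (\<lambda>j. 0)"
    by (simp add: schmidt_def sing_val_zero fun_eq_iff)
  thus ?thesis by (simp add: adm_vec_def adm_seq_def Let_def)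
qed

text \<open>Singular values of the coefficient matrices are bounded by characteristic polynomial
  values at -1, which converge. Along a subsequence they converge themselves, necessarily to those
  of the limit matrix, and admissibility passes to the limit.\<close>

lemma adm_vec_limit:
  assumes adm: "\<And>l. adm_vec n m \<alpha> (\<phi> l)" and \<phi>0: "\<phi>0 \<in> carrier_vec (n * m)"
    and lim: "\<And>p. p < n * m \<Longrightarrow> (\<lambda>l. \<phi> l $ p) \<longlonglongrightarrow> \<phi>0 $ p"
  shows "adm_vec n m \<alpha> \<phi>0"
proof -
  define A where "A l = coef_mat n m (\<phi> l)" for l
  define A0 where "A0 = coef_mat n m \<phi>0"
  have A: "A l \<in> carrier_mat n m" for l by (simp add: A_def)
  have A0: "A0 \<in> carrier_mat n m" by (simp add: A0_def)
  have limA: "(\<lambda>l. A l $$ (i, j)) \<longlonglongrightarrow> A0 $$ (i, j)"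
    if "i < n" "j < m" for i j
    using lim[OF tensor_index_less[OF that]] that by (simp add: A_def A0_def coef_mat_def)
  have "Bseq (\<lambda>l. poly (char_poly (mat_adjoint (A l) * A l)) (- 1))"
    by (rule convergent_imp_Bseq, rule convergentI, rule tendsto_poly_gram[OF A A0 limA])
  then obtain K where K: "\<And>l. cmod (poly (char_poly (mat_adjoint (A l) * A l)) (- 1)) \<le> K"
    unfolding Bseq_def by blast
  \<comment> \<open>Only indices 1 to m matter, as the coefficient matrix has m columns; the
    embedding into the complex numbers is undone below by real parts.\<close>
  have "\<exists>r. strict_mono (r :: nat \<Rightarrow> nat) \<and>
      (\<exists>L. \<forall>j\<in>{1..m}. (\<lambda>l. complex_of_real (sing_val (A (r l)) j)) \<longlonglongrightarrow> L j)"
  proof (rule common_convergent_subseq)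
    fix j l
    show "cmod (complex_of_real (sing_val (A l) j)) \<le> K"
      using sing_val_nonneg[OF A, of l j]
        sing_val_le_cmod_poly[OF A, of l j] K[of l] by simp
  qed simp
  then obtain r L where rL: "strict_mono r \<and> (\<forall>j\<in>{1..m}. (\<lambda>l. complex_of_real (sing_val (A (r l)) j)) \<longlonglongrightarrow> L j)"
    by (elim exE conjE) (rule that, simp)
  have "(\<lambda>l. sing_val (A (r l)) j) \<longlonglongrightarrow> sing_val A0 j" for j
  proof (rule sing_val_limit[where s = "\<lambda>j. Re (L j)"])
    fix i j assume "i < n" "j < m"
    from LIMSEQ_subseq_LIMSEQ[OF limA[OF this], of r] rL
    show "(\<lambda>l. A (r l) $$ (i, j)) \<longlonglongrightarrow> A0 $$ (i, j)"
      by (simp add: o_def)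
  next
    fix j assume "1 \<le> j" "j \<le> m"
    with rL have "(\<lambda>l. complex_of_real (sing_val (A (r l)) j)) \<longlonglongrightarrow> L j"
      by simp
    from tendsto_Re[OF this] show "(\<lambda>l. sing_val (A (r l)) j) \<longlonglongrightarrow> Re (L j)"
      by simp
  qed (rule A A0)+
  hence "adm_seq \<alpha> (sing_val A0)"
    by (rule adm_seq_limit[rotated]) (use adm in \<open>auto simp: adm_vec_def schmidt_def A_def\<close>)
  thus ?thesis using \<phi>0 by (simp add: adm_vec_def schmidt_def A0_def)
qed

lemma proj_index:
  "\<phi> \<in> carrier_vec d \<Longrightarrow> p < d \<Longrightarrow> q < d \<Longrightarrow> proj \<phi> $$ (p, q) = \<phi> $ p * cnj (\<phi> $ q)"
  by (simp add: proj_def)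

lemma proj_smult:
  "proj (complex_of_real c \<cdot>\<^sub>v \<phi>) = complex_of_real (c\<^sup>2) \<cdot>\<^sub>m proj \<phi>"
  by (intro eq_matI) (auto simp: proj_def power2_eq_square)

lemma msum_index: "p < r \<Longrightarrow> q < c \<Longrightarrow> msum r c f N $$ (p, q) = (\<Sum>i<N. f i $$ (p, q))"
  by (simp add: msum_def)

lemma msum_carrier [simp]: "msum r c f N \<in> carrier_mat r c"
  by (simp add: msum_def)

lemma msum_eqI:
  assumes "C \<in> carrier_mat r c"
    and "\<And>p q. p < r \<Longrightarrow> q < c \<Longrightarrow> C $$ (p, q) = (\<Sum>i<N. f i $$ (p, q))"
  shows "C = msum r c f N"
  by (rule eq_matI) (use assms in \<open>simp_all add: msum_def\<close>)

lemma msum_cong: "(\<And>i. i < N \<Longrightarrow> f i = g i) \<Longrightarrow> msum r c f N = msum r c g N"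
  by (rule eq_matI) (simp_all add: msum_def)

lemma smult_proj_eq:
  "0 \<le> t \<Longrightarrow> complex_of_real t \<cdot>\<^sub>m proj \<psi> = proj (complex_of_real (sqrt t) \<cdot>\<^sub>v \<psi>)"
  by (simp only: proj_smult real_sqrt_pow2)

section \<open>Decompositions of cone elements and closedness of the cone\<close>

lemma adm_decomp_cone:
  assumes "C \<in> cone_alpha n m \<alpha>"
  shows "\<exists>N. adm_decomp n m \<alpha> N C"
proof -
  from assms obtain N t \<psi> where C: "C = msum (n*m) (n*m) (\<lambda>i. complex_of_real (t i) \<cdot>\<^sub>m proj (\<psi> i)) N"
    and t: "\<And>i. i < N \<Longrightarrow> t i \<ge> 0 \<and> \<psi> i \<in> V_alpha n m \<alpha>"
    unfolding cone_alpha_def by blast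
  define \<phi> where "\<phi> i = complex_of_real (sqrt (t i)) \<cdot>\<^sub>v \<psi> i" for i
  have "adm_vec n m \<alpha> (\<phi> i)" if "i < N" for i
  \<comment> \<open>Scaling of admissible vectors covers positive factors; a zero weight yields the
    zero vector instead.\<close>
  proof (cases "t i = 0")
    case True
    have "\<psi> i \<in> carrier_vec (n * m)"
      using t[OF that] by (simp add: V_alpha_def unit_vec_nm_def)
    hence "\<phi> i = 0\<^sub>v (n * m)" using True by (auto simp: \<phi>_def)
    thus ?thesis using adm_vec_zero by simp
  next
    case False
    have "adm_vec n m \<alpha> (\<psi> i)"
      using t[OF that] by (auto simp: adm_vec_def V_alpha_def unit_vec_nm_def)
    thus ?thesis using False t[OF that] by (simp add: \<phi>_def adm_vec_smult)
  qed
  moreover have "C = msum (n*m) (n*m) (\<lambda>i. proj (\<phi> i)) N"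
    unfolding C \<phi>_def using t by (intro msum_cong smult_proj_eq) auto
  ultimately show ?thesis unfolding adm_decomp_def by blast
qed

text \<open>Relabels a finite index set as an initial segment, the only kind of index set
  \<open>msum\<close> accepts.\<close>

lemma sum_reindex_lessThan:
  assumes "finite I"
  obtains h where "bij_betw h {..<card I} I"
    "\<And>f :: 'a \<Rightarrow> 'b :: comm_monoid_add. (\<Sum>l<card I. f (h l)) = sum f I"
proof -
  from ex_bij_betw_nat_finite[OF assms] obtain h where h: "bij_betw h {..<card I} I"
    by (auto simp: lessThan_atLeast0)
  show thesis by (rule that[OF h]) (use sum.reindex_bij_betw[OF h] in auto)
qed

text \<open>Each nonzero vector is normalised, its squared norm becoming the weight. Zero vectors
  are dropped, so the number of terms may shrink.\<close>

lemma adm_decomp_unit: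
  assumes "adm_decomp n m \<alpha> N C"
  shows "\<exists>N'\<le>N. \<exists>\<psi> t. (\<forall>i<N'. \<psi> i \<in> V_alpha n m \<alpha> \<and> t i > 0) \<and>
     C = msum (n*m) (n*m) (\<lambda>i. complex_of_real (t i) \<cdot>\<^sub>m proj (\<psi> i)) N'"
proof -
  from assms obtain \<phi> where \<phi>: "\<And>i. i < N \<Longrightarrow> adm_vec n m \<alpha> (\<phi> i)"
    and C: "C = msum (n * m) (n * m) (\<lambda>i. proj (\<phi> i)) N"
    unfolding adm_decomp_def by blast
  define t where "t i = (\<Sum>p<n * m. (cmod (\<phi> i $ p))\<^sup>2)" for i
  define \<psi> where "\<psi> i = complex_of_real (1 / sqrt (t i)) \<cdot>\<^sub>v \<phi> i" for i
  define I where "I = {i. i < N \<and> t i \<noteq> 0}"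
  have "finite I" by (simp add: I_def)
  then obtain h where h: "bij_betw h {..<card I} I"
      and sum_h: "\<And>f :: nat \<Rightarrow> complex. (\<Sum>l<card I. f (h l)) = sum f I"
    by (rule sum_reindex_lessThan) blast
  have hI: "h l \<in> I" if "l < card I" for l using h that by (auto simp: bij_betw_def)
  have t0: "t i \<ge> 0" for i by (simp add: t_def sum_nonneg)
  have tI: "t i > 0" if "i \<in> I" for i using that t0[of i] by (auto simp: I_def less_le)
  have carr: "\<phi> i \<in> carrier_vec (n * m)"
    if "i < N" for i using \<phi>[OF that] by (simp add: adm_vec_def)
  have \<psi>: "\<psi> i \<in> V_alpha n m \<alpha>" if i: "i \<in> I" for i
  proof -
    have iN: "i < N" using i by (simp add: I_def)
    have "adm_vec n m \<alpha> (\<psi> i)"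
      unfolding \<psi>_def by (rule adm_vec_smult) (use iN \<phi> tI[OF i] in auto)
    moreover have "(\<Sum>p<n * m. (cmod (\<psi> i $ p))\<^sup>2) = (\<Sum>p<n * m. (cmod (\<phi> i $ p))\<^sup>2 / t i)"
      using carr[OF iN] t0[of i] by (intro sum.cong) (auto simp: \<psi>_def norm_divide power_divide norm_mult)
    hence "(\<Sum>p<n * m. (cmod (\<psi> i $ p))\<^sup>2) = 1"
      using tI[OF i] by (simp add: sum_divide_distrib[symmetric] t_def)
    ultimately show ?thesis by (simp add: V_alpha_def unit_vec_nm_def adm_vec_def)
  qed
  have proj_\<phi>: "complex_of_real (t i) \<cdot>\<^sub>m proj (\<psi> i) = proj (\<phi> i)"
    if "i \<in> I" for i
    using tI[OF that] by (simp add: smult_proj_eq \<psi>_def smult_smult_assoc)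
  have "C = msum (n*m) (n*m) (\<lambda>l. complex_of_real (t (h l)) \<cdot>\<^sub>m proj (\<psi> (h l))) (card I)"
  proof (rule msum_eqI)
    show "C \<in> carrier_mat (n*m) (n*m)" by (simp add: C)
    fix p q assume pq: "p < n * m" "q < n * m"
    have "C $$ (p, q) = (\<Sum>i<N. proj (\<phi> i) $$ (p, q))" using pq by (simp add: C msum_index)
    also have "\<dots> = (\<Sum>i\<in>I. proj (\<phi> i) $$ (p, q))"
    proof (rule sum.mono_neutral_right)
      \<comment> \<open>Outside \<open>I\<close> the squared norm is zero, hence so is every
        coordinate.\<close>
      show "\<forall>i\<in>{..<N} - I. proj (\<phi> i) $$ (p, q) = 0"
      proof
        fix i assume i: "i \<in> {..<N} - I"
        hence "\<phi> i $ p = 0" using pq by (auto simp: I_def t_def sum_nonneg_eq_0_iff)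
        thus "proj (\<phi> i) $$ (p, q) = 0" using i pq carr by (simp add: proj_index[of _ "n * m"])
      qed
    qed (auto simp: I_def)
    also have "\<dots> = (\<Sum>l<card I. proj (\<phi> (h l)) $$ (p, q))"
      by (rule sum_h[of "\<lambda>i. proj (\<phi> i) $$ (p, q)", symmetric])
    also have "\<dots> = (\<Sum>l<card I. (complex_of_real (t (h l)) \<cdot>\<^sub>m proj (\<psi> (h l))) $$ (p, q))"
      using hI by (simp add: proj_\<phi>)
    finally show "C $$ (p, q) = (\<Sum>l<card I. (complex_of_real (t (h l)) \<cdot>\<^sub>m proj (\<psi> (h l))) $$ (p, q))" .
  qed
  moreover have "card I \<le> N" using card_mono[of "{..<N}" I] by (auto simp: I_def)
  ultimately show ?thesis using \<psi> tI hI
    by (intro exI[of _ "card I"] conjI exI[of _ "\<lambda>l. \<psi> (h l)"] exI[of _ "\<lambda>l. t (h l)"]) auto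
qed

text \<open>Zero vectors fill the missing terms, which makes upper bounds on the number of terms
  exact.\<close>

lemma adm_decomp_pad:
  assumes "adm_decomp n m \<alpha> N C" "N \<le> M"
  shows "adm_decomp n m \<alpha> M C"
proof -
  from assms obtain \<phi> where \<phi>: "\<And>i. i < N \<Longrightarrow> adm_vec n m \<alpha> (\<phi> i)"
    and C: "C = msum (n * m) (n * m) (\<lambda>i. proj (\<phi> i)) N"
    unfolding adm_decomp_def by blast
  let ?\<psi> = "\<lambda>i. if i < N then \<phi> i else 0\<^sub>v (n * m)"
  have "C = msum (n * m) (n * m) (\<lambda>i. proj (?\<psi> i)) M"
  proof (rule msum_eqI)
    show "C \<in> carrier_mat (n*m) (n*m)" by (simp add: C)
    fix p q assume pq: "p < n * m" "q < n * m"
    have "(\<Sum>i<N. proj (\<phi> i) $$ (p, q)) = (\<Sum>i<M. proj (?\<psi> i) $$ (p, q))"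
      using assms(2) pq by (intro sum.mono_neutral_cong_left) (auto simp: proj_index[of _ "n * m"])
    thus "C $$ (p, q) = (\<Sum>i<M. proj (?\<psi> i) $$ (p, q))"
      using pq by (simp add: C msum_index)
  qed
  thus ?thesis using \<phi> adm_vec_zero unfolding adm_decomp_def
    by (intro exI[of _ ?\<psi>]) auto
qed

text \<open>A Hermitian matrix of size \<open>d\<close> is determined by \<open>d\<^sup>2\<close> real coordinates: the real parts on and
  above the diagonal and the imaginary parts strictly below it.\<close>

lemma adm_decomp_caratheodory:
  assumes "adm_decomp n m \<alpha> N C"
  shows "adm_decomp n m \<alpha> ((n * m)\<^sup>2) C"
proof -
  let ?d = "n * m"
  from assms obtain \<phi> where \<phi>: "\<And>i. i < N \<Longrightarrow> adm_vec n m \<alpha> (\<phi> i)"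
    and C: "C = msum ?d ?d (\<lambda>i. proj (\<phi> i)) N"
    unfolding adm_decomp_def by blast
  have carr: "\<phi> i \<in> carrier_vec ?d"
    if "i < N" for i using \<phi>[OF that] by (simp add: adm_vec_def)
  define e where "e i p q = \<phi> i $ p * cnj (\<phi> i $ q)" for i p q
  define v where "v i = (\<lambda>(p, q). if p \<le> q then Re (e i p q) else Im (e i p q))" for i
  obtain I t where I: "I \<subseteq> {..<N}" "card I \<le> card ({..<?d} \<times> {..<?d})"
    "\<forall>i\<in>I. 0 < t i"
      and v: "\<forall>j\<in>{..<?d} \<times> {..<?d}. (\<Sum>i\<in>I. t i * v i j) = (\<Sum>i<N. 1 * v i j)"
    using conic_caratheodory[of "{..<?d} \<times> {..<?d}" "{..<N}" "\<lambda>_. 1" v] by auto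
  have finI: "finite I" using I(1) finite_subset by blast
  have v': "(\<Sum>i\<in>I. t i * v i (p, q)) = (\<Sum>i<N. v i (p, q))"
    if "p < ?d" "q < ?d" for p q
    using v that by auto
  \<comment> \<open>Hermitian symmetry recovers the parts not stored in \<open>v\<close>: real parts
    below the diagonal, imaginary parts on and above it.\<close>
  have swap: "Re (e i p q) = Re (e i q p)" "Im (e i p q) = - Im (e i q p)"
    "Im (e i p p) = 0" for i p q
    by (simp_all add: e_def)
  have Re: "(\<Sum>i\<in>I. t i * Re (e i p q)) = (\<Sum>i<N. Re (e i p q))"
    if pq: "p < ?d" "q < ?d" for p q
  proof (cases "p \<le> q")
    case True
    thus ?thesis using v'[OF pq] by (simp add: v_def)
  next
    case False
    thus ?thesis using v'[OF pq(2,1)] by (simp add: v_def swap(1)[of _ p q])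
  qed
  have Im: "(\<Sum>i\<in>I. t i * Im (e i p q)) = (\<Sum>i<N. Im (e i p q))"
    if pq: "p < ?d" "q < ?d" for p q
  proof -
    consider "p < q" | "p = q" | "q < p" by linarith
    thus ?thesis
    proof cases
      case 1
      thus ?thesis using v'[OF pq(2,1)] by (simp add: v_def swap(2)[of _ p q] sum_negf)
    next
      case 3
      thus ?thesis using v'[OF pq] by (simp add: v_def)
    qed (simp add: swap(3))
  qed
  obtain h where h: "bij_betw h {..<card I} I"
      and sum_h: "\<And>f :: nat \<Rightarrow> complex. (\<Sum>l<card I. f (h l)) = sum f I"
    using finI by (rule sum_reindex_lessThan) blast
  have hI: "h l \<in> I" if "l < card I" for l using h that by (auto simp: bij_betw_def)
  let ?\<psi> = "\<lambda>i. complex_of_real (sqrt (t i)) \<cdot>\<^sub>v \<phi> i"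
  have "C = msum ?d ?d (\<lambda>l. proj (?\<psi> (h l))) (card I)"
  proof (rule msum_eqI)
    show "C \<in> carrier_mat ?d ?d" by (simp add: C)
    fix p q assume pq: "p < ?d" "q < ?d"
    have "C $$ (p, q) = (\<Sum>i<N. e i p q)"
      using pq carr by (simp add: C msum_index proj_index[of _ ?d] e_def)
    also have "\<dots> = (\<Sum>i\<in>I. complex_of_real (t i) * e i p q)"
      using Re[OF pq] Im[OF pq] by (simp add: complex_eq_iff)
    also have "\<dots> = (\<Sum>i\<in>I. proj (?\<psi> i) $$ (p, q))"
    proof (rule sum.cong)
      fix i assume i: "i \<in> I"
      hence "0 \<le> t i" "\<phi> i \<in> carrier_vec ?d" using I carr by (auto simp: less_imp_le)
      moreover have "(complex_of_real (t i) \<cdot>\<^sub>m proj (\<phi> i)) $$ (p, q) = complex_of_real (t i) * e i p q"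
        using calculation pq by (simp add: proj_def e_def)
      ultimately show "complex_of_real (t i) * e i p q = proj (?\<psi> i) $$ (p, q)"
        by (simp only: smult_proj_eq)
    qed simp
    also have "\<dots> = (\<Sum>l<card I. proj (?\<psi> (h l)) $$ (p, q))"
      by (rule sum_h[of "\<lambda>i. proj (?\<psi> i) $$ (p, q)", symmetric])
    finally show "C $$ (p, q) = (\<Sum>l<card I. proj (?\<psi> (h l)) $$ (p, q))" .
  qed
  moreover have "adm_vec n m \<alpha> (?\<psi> (h l))" if "l < card I" for l
    using hI[OF that] I \<phi> by (intro adm_vec_smult) auto
  ultimately have dec: "adm_decomp n m \<alpha> (card I) C" unfolding adm_decomp_def
    by (intro exI[of _ "\<lambda>l. ?\<psi> (h l)"]) auto
  have "card I \<le> ?d\<^sup>2" using I(2) by (simp only: card_cartesian_product card_lessThan power2_eq_square)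
  thus ?thesis by (rule adm_decomp_pad[OF dec])
qed

text \<open>A diagonal entry is a sum of squared moduli, so convergence bounds every coordinate of
  every vector. With N fixed there are finitely many coordinates, and a common subsequence converges
  to a decomposition of the limit.\<close>

lemma adm_decomp_closed:
  assumes X: "\<And>l. adm_decomp n m \<alpha> N (X l)" and C: "C \<in> carrier_mat (n * m) (n * m)"
    and lim: "\<And>p q. p < n * m \<Longrightarrow> q < n * m \<Longrightarrow> (\<lambda>l. X l $$ (p, q)) \<longlonglongrightarrow> C $$ (p, q)"
  shows "adm_decomp n m \<alpha> N C"
proof -
  let ?d = "n * m"
  from X obtain \<phi> where \<phi>: "\<And>l i. i < N \<Longrightarrow> adm_vec n m \<alpha> (\<phi> l i)"
    and Xl: "\<And>l. X l = msum ?d ?d (\<lambda>i. proj (\<phi> l i)) N"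
    unfolding adm_decomp_def by metis
  have carr: "\<phi> l i \<in> carrier_vec ?d"
    if "i < N" for l i using \<phi>[OF that] by (simp add: adm_vec_def)
  have entry: "X l $$ (p, q) = (\<Sum>i<N. \<phi> l i $ p * cnj (\<phi> l i $ q))"
    if "p < ?d" "q < ?d" for l p q
    using that carr by (simp add: Xl msum_index proj_index[of _ ?d])
  have "\<forall>p. \<exists>B. p < ?d \<longrightarrow> (\<forall>l. cmod (X l $$ (p, p)) \<le> B)"
  proof
    fix p
    show "\<exists>B. p < ?d \<longrightarrow> (\<forall>l. cmod (X l $$ (p, p)) \<le> B)"
    proof (cases "p < ?d")
      case True
      hence "Bseq (\<lambda>l. X l $$ (p, p))"
        using lim[of p p] by (intro convergent_imp_Bseq convergentI)
      thus ?thesis unfolding Bseq_def by blast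
    qed simp
  qed
  then obtain B where B: "\<And>p l. p < ?d \<Longrightarrow> cmod (X l $$ (p, p)) \<le> B p"
    by metis
  \<comment> \<open>The bound \<open>1 + B p\<close> on the modulus comes from 2x \<le> 1 + x^2 and
    avoids square roots.\<close>
  have bound: "cmod (\<phi> l i $ p) \<le> 1 + B p" if "i < N" "p < ?d" for l i p
  proof -
    have "(cmod (\<phi> l i $ p))\<^sup>2 \<le> (\<Sum>i<N. (cmod (\<phi> l i $ p))\<^sup>2)"
      using that by (intro member_le_sum) auto
    also have "\<dots> = cmod (complex_of_real (\<Sum>i<N. (cmod (\<phi> l i $ p))\<^sup>2))"
      by (simp only: norm_of_real) (simp add: sum_nonneg)
    also have "complex_of_real (\<Sum>i<N. (cmod (\<phi> l i $ p))\<^sup>2) = X l $$ (p, p)"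
      using entry[OF that(2,2)] by (simp only: of_real_sum complex_norm_square)
    finally have "(cmod (\<phi> l i $ p))\<^sup>2 \<le> B p"
      using B[OF that(2)] order_trans by blast
    moreover have "2 * x \<le> 1 + x\<^sup>2" for x :: real
      using zero_le_power2[of "x - 1"] by (simp add: power2_eq_square algebra_simps)
    ultimately show ?thesis by (smt (verit) norm_ge_zero)
  qed
  have "\<exists>r. strict_mono (r :: nat \<Rightarrow> nat) \<and>
      (\<exists>L. \<forall>a\<in>{..<N} \<times> {..<?d}. (\<lambda>l. (\<lambda>(i, p) l. \<phi> l i $ p) a (r l)) \<longlonglongrightarrow> L a)"
    by (rule common_convergent_subseq[where B = "\<lambda>(i, p). 1 + B p"]) (use bound in auto)
  then obtain r L where rL: "strict_mono r \<and> (\<forall>a\<in>{..<N} \<times> {..<?d}. (\<lambda>l. (\<lambda>(i, p) l. \<phi> l i $ p) a (r l)) \<longlonglongrightarrow> L a)"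
    by (elim exE conjE) (rule that, simp)
  hence L: "(\<lambda>l. \<phi> (r l) i $ p) \<longlonglongrightarrow> L (i, p)"
    if "i < N" "p < ?d" for i p using that by auto
  define \<phi>0 where "\<phi>0 i = vec ?d (\<lambda>p. L (i, p))" for i
  have "adm_vec n m \<alpha> (\<phi>0 i)" if "i < N" for i
    by (rule adm_vec_limit[of n m \<alpha> "\<lambda>l. \<phi> (r l) i"]) (use that \<phi> L in \<open>auto simp: \<phi>0_def\<close>)
  moreover have "C = msum ?d ?d (\<lambda>i. proj (\<phi>0 i)) N"
  proof (rule msum_eqI[OF C])
    fix p q assume pq: "p < ?d" "q < ?d"
    have "(\<lambda>l. X (r l) $$ (p, q)) \<longlonglongrightarrow> C $$ (p, q)"
      using LIMSEQ_subseq_LIMSEQ[OF lim[OF pq], of r] rL by (simp add: o_def)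
    moreover have "(\<lambda>l. X (r l) $$ (p, q)) \<longlonglongrightarrow> (\<Sum>i<N. L (i, p) * cnj (L (i, q)))"
      unfolding entry[OF pq] using pq by (intro tendsto_sum tendsto_mult tendsto_cnj L) auto
    ultimately have "C $$ (p, q) = (\<Sum>i<N. L (i, p) * cnj (L (i, q)))" by (rule LIMSEQ_unique)
    thus "C $$ (p, q) = (\<Sum>i<N. proj (\<phi>0 i) $$ (p, q))"
      using pq by (simp add: \<phi>0_def proj_def)
  qed
  ultimately show ?thesis unfolding adm_decomp_def by blast
qed

text \<open>Caratheodory is applied to each approximating matrix first, giving all of them the same
  number of terms before the limit is taken.\<close>

lemma K_alpha_adm_decomp:
  assumes "C \<in> K_alpha n m \<alpha>"
  shows "adm_decomp n m \<alpha> ((n * m)\<^sup>2) C"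
proof -
  from assms obtain X where C: "C \<in> carrier_mat (n * m) (n * m)"
    and X: "\<And>l. X l \<in> cone_alpha n m \<alpha>"
    and lim: "\<And>p q. p < n * m \<Longrightarrow> q < n * m \<Longrightarrow> (\<lambda>l. X l $$ (p, q)) \<longlonglongrightarrow> C $$ (p, q)"
    unfolding K_alpha_def by blast
  have "adm_decomp n m \<alpha> ((n * m)\<^sup>2) (X l)" for l
    using adm_decomp_cone[OF X] adm_decomp_caratheodory by blast
  from adm_decomp_closed[OF this C lim] show ?thesis .
qed

lemma cone_alpha_subset_K_alpha: "C \<in> cone_alpha n m \<alpha> \<Longrightarrow> C \<in> K_alpha n m \<alpha>"
  unfolding K_alpha_def mem_Collect_eq
  by (intro conjI exI[of _ "\<lambda>_. C"]) (auto simp: cone_alpha_def)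

subsection \<open>Kraus operators\<close>

lemma kraus_index:
  fixes A X :: "complex mat"
  assumes A: "A \<in> carrier_mat m n" and X: "X \<in> carrier_mat n n" and ab: "a < m" "b < m"
  shows "(A * X * mat_adjoint A) $$ (a, b) = (\<Sum>i<n. \<Sum>j<n. X $$ (i, j) * (A $$ (a, i) * cnj (A $$ (b, j))))"
proof -
  have AX: "A * X \<in> carrier_mat m n" using A X by simp
  have "(A * X * mat_adjoint A) $$ (a, b) = (\<Sum>j<n. (A * X) $$ (a, j) * mat_adjoint A $$ (j, b))"
    by (rule mat_mult_index_sum[OF AX mat_adjoint_carrier[OF A] ab])
  also have "\<dots> = (\<Sum>j<n. (\<Sum>i<n. A $$ (a, i) * X $$ (i, j)) * cnj (A $$ (b, j)))"
    using mat_mult_index_sum[OF A X ab(1)] mat_adjoint_index[OF A _ ab(2)] by simp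
  also have "\<dots> = (\<Sum>j<n. \<Sum>i<n. X $$ (i, j) * (A $$ (a, i) * cnj (A $$ (b, j))))"
    by (simp add: sum_distrib_left sum_distrib_right mult_ac)
  finally show ?thesis by (subst sum.swap)
qed

lemma E_unit_carrier [simp]: "E_unit n i j \<in> carrier_mat n n"
  by (simp add: E_unit_def)

lemma kraus_E_unit:
  fixes A :: "complex mat"
  assumes A: "A \<in> carrier_mat m n" and ab: "a < m" "b < m" and ij: "i < n" "j < n"
  shows "(A * E_unit n i j * mat_adjoint A) $$ (a, b) = A $$ (a, i) * cnj (A $$ (b, j))"
proof -
  have "(A * E_unit n i j * mat_adjoint A) $$ (a, b)
    = (\<Sum>i'<n. \<Sum>j'<n. if j' = j then (if i' = i then A $$ (a, i) * cnj (A $$ (b, j)) else 0) else 0)"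
    unfolding kraus_index[OF A E_unit_carrier ab] by (intro sum.cong) (auto simp: E_unit_def)
  also have "\<dots> = A $$ (a, i) * cnj (A $$ (b, j))" using ij by simp
  finally show ?thesis .
qed

text \<open>A linear map is determined by its values on matrix units. As \<open>lin_map\<close>
  provides only binary additivity, the expansion is built up one matrix position at a time.\<close>

lemma lin_map_index:
  assumes \<Phi>: "lin_map n m \<Phi>" and X: "X \<in> carrier_mat n n" and ab: "a < m" "b < m"
  shows "\<Phi> X $$ (a, b) = (\<Sum>i<n. \<Sum>j<n. X $$ (i, j) * \<Phi> (E_unit n i j) $$ (a, b))"
proof -
  from \<Phi> have carr: "\<And>X. X \<in> carrier_mat n n \<Longrightarrow> \<Phi> X \<in> carrier_mat m m"
    and add: "\<And>X Y. X \<in> carrier_mat n n \<Longrightarrow> Y \<in> carrier_mat n n \<Longrightarrow> \<Phi> (X + Y) = \<Phi> X + \<Phi> Y"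
    and smult: "\<And>c X. X \<in> carrier_mat n n \<Longrightarrow> \<Phi> (c \<cdot>\<^sub>m X) = c \<cdot>\<^sub>m \<Phi> X"
    unfolding lin_map_def by blast+
  \<comment> \<open>\<open>R S\<close> keeps the entries of \<open>X\<close> at positions in
    \<open>S\<close> and replaces the others by 0.\<close>
  define R where "R S = mat n n (\<lambda>ij. if ij \<in> S then X $$ ij else 0)" for S
  have RC: "R S \<in> carrier_mat n n" for S by (simp add: R_def)
  have "\<Phi> (R S) $$ (a, b) = (\<Sum>(i, j)\<in>S. X $$ (i, j) * \<Phi> (E_unit n i j) $$ (a, b))"
    if "finite S" "S \<subseteq> {..<n} \<times> {..<n}" for S
    using that
  proof (induction S rule: finite_induct)
    case empty
    \<comment> \<open>That \<Phi> vanishes at the zero matrix comes from homogeneity with scalar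
      0.\<close>
    have "R {} = 0 \<cdot>\<^sub>m R {}" by (intro eq_matI) (auto simp: R_def)
    hence "\<Phi> (R {}) = 0 \<cdot>\<^sub>m \<Phi> (R {})" using smult[OF RC] by metis
    moreover have "(0 \<cdot>\<^sub>m \<Phi> (R {})) $$ (a, b) = 0"
      using carr[OF RC, of "{}"] ab by simp
    ultimately show ?case by simp
  next
    case (insert x S)
    obtain i j where x: "x = (i, j)" by force
    have "R (insert x S) = R S + X $$ (i, j) \<cdot>\<^sub>m E_unit n i j"
      using insert.hyps x by (intro eq_matI) (auto simp: R_def E_unit_def)
    hence "\<Phi> (R (insert x S)) = \<Phi> (R S) + X $$ (i, j) \<cdot>\<^sub>m \<Phi> (E_unit n i j)"
      using RC by (simp add: add smult)
    hence "\<Phi> (R (insert x S)) $$ (a, b) = \<Phi> (R S) $$ (a, b) + X $$ (i, j) * \<Phi> (E_unit n i j) $$ (a, b)"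
      using carr[OF E_unit_carrier, of i j] carr[OF RC, of S] ab by simp
    thus ?case using insert x by (simp add: add.commute)
  qed
  from this[of "{..<n} \<times> {..<n}"] have
    "\<Phi> (R ({..<n} \<times> {..<n})) $$ (a, b) = (\<Sum>(i, j)\<in>{..<n} \<times> {..<n}. X $$ (i, j) * \<Phi> (E_unit n i j) $$ (a, b))"
    by simp
  moreover have "R ({..<n} \<times> {..<n}) = X" using X by (intro eq_matI) (auto simp: R_def)
  ultimately show ?thesis by (simp add: sum.cartesian_product)
qed

text \<open>The Choi matrix of X -> A X A^* is the rank-one matrix of the vector stacking the
  columns of A, whose coefficient matrix is the transpose of A.\<close>

lemma adm_decomp_of_kraus:
  assumes A: "\<And>i. i < N \<Longrightarrow> A i \<in> carrier_mat m n \<and> adm_mat \<alpha> (A i)"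
    and \<Phi>: "\<And>X. X \<in> carrier_mat n n \<Longrightarrow> \<Phi> X = msum m m (\<lambda>i. A i * X * mat_adjoint (A i)) N"
  shows "adm_decomp n m \<alpha> N (choi n m \<Phi>)"
proof -
  define \<phi> where "\<phi> l = vec (n * m) (\<lambda>p. A l $$ (p mod m, p div m))" for l
  have "adm_vec n m \<alpha> (\<phi> l)" if "l < N" for l
  proof -
    have Al: "A l \<in> carrier_mat m n" "adm_mat \<alpha> (A l)" using A[OF that] by auto
    have "coef_mat n m (\<phi> l) = transpose_mat (A l)"
      using Al by (intro eq_matI) (auto simp: coef_mat_def \<phi>_def tensor_index_less)
    thus ?thesis using Al sing_val_transpose[OF Al(1)]
      by (simp add: adm_vec_def adm_mat_def schmidt_def \<phi>_def)
  qed
  moreover have "choi n m \<Phi> = msum (n * m) (n * m) (\<lambda>l. proj (\<phi> l)) N"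
  proof (rule msum_eqI)
    show "choi n m \<Phi> \<in> carrier_mat (n * m) (n * m)" by (simp add: choi_def)
    fix p q assume pq: "p < n * m" "q < n * m"
    \<comment> \<open>Positivity of m, forced by the existence of the index \<open>p\<close>, makes
      div and mod recover the two tensor indices.\<close>
    hence "0 < m" by (cases m) auto
    hence lt: "p div m < n" "q div m < n" "p mod m < m" "q mod m < m"
      using pq by (auto simp: less_mult_imp_div_less)
    have "choi n m \<Phi> $$ (p, q) = (\<Sum>l<N. (A l * E_unit n (p div m) (q div m) * mat_adjoint (A l)) $$ (p mod m, q mod m))"
      using pq lt by (simp add: choi_def \<Phi> msum_index)
    also have "\<dots> = (\<Sum>l<N. proj (\<phi> l) $$ (p, q))"
      using A lt pq by (intro sum.cong refl) (simp add: kraus_E_unit[of _ m n] proj_def \<phi>_def del: index_mult_mat)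
    finally show "choi n m \<Phi> $$ (p, q) = (\<Sum>l<N. proj (\<phi> l) $$ (p, q))" .
  qed
  ultimately show ?thesis unfolding adm_decomp_def by blast
qed

text \<open>Unstacking each vector gives a Kraus operator. The entries of the Choi matrix are those
  of \<Phi> on matrix units, and these determine \<Phi>.\<close>

lemma kraus_of_adm_decomp:
  assumes \<Phi>: "lin_map n m \<Phi>" and dec: "adm_decomp n m \<alpha> N (choi n m \<Phi>)"
  shows "\<exists>A. (\<forall>i<N. A i \<in> carrier_mat m n \<and> adm_mat \<alpha> (A i)) \<and>
    (\<forall>X \<in> carrier_mat n n. \<Phi> X = msum m m (\<lambda>i. A i * X * mat_adjoint (A i)) N)"
proof -
  from dec obtain \<phi> where \<phi>: "\<And>i. i < N \<Longrightarrow> adm_vec n m \<alpha> (\<phi> i)"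
    and C: "choi n m \<Phi> = msum (n * m) (n * m) (\<lambda>i. proj (\<phi> i)) N"
    unfolding adm_decomp_def by blast
  define A where "A l = transpose_mat (coef_mat n m (\<phi> l))" for l
  have A: "A l \<in> carrier_mat m n" for l by (simp add: A_def)
  have "adm_mat \<alpha> (A l)" if "l < N" for l
    using \<phi>[OF that] sing_val_transpose[OF coef_mat_carrier, of n m "\<phi> l"]
    by (simp add: adm_mat_def A_def adm_vec_def schmidt_def)
  moreover have "\<Phi> X = msum m m (\<lambda>i. A i * X * mat_adjoint (A i)) N"
    if X: "X \<in> carrier_mat n n" for X
  proof (rule msum_eqI)
    show "\<Phi> X \<in> carrier_mat m m" using \<Phi> X by (simp add: lin_map_def)
    fix a b assume ab: "a < m" "b < m"
    have E: "\<Phi> (E_unit n i j) $$ (a, b) = (\<Sum>l<N. A l $$ (a, i) * cnj (A l $$ (b, j)))"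
      if ij: "i < n" "j < n" for i j
    proof -
      have lt: "i * m + a < n * m" "j * m + b < n * m"
        using ab ij by (auto intro: tensor_index_less)
      have "\<Phi> (E_unit n i j) $$ (a, b) = choi n m \<Phi> $$ (i * m + a, j * m + b)"
        using lt ab by (simp add: choi_def)
      also have "\<dots> = (\<Sum>l<N. proj (\<phi> l) $$ (i * m + a, j * m + b))"
        using lt by (simp add: C msum_index)
      also have "\<dots> = (\<Sum>l<N. A l $$ (a, i) * cnj (A l $$ (b, j)))"
      proof (rule sum.cong)
        fix l assume "l \<in> {..<N}"
        hence "\<phi> l \<in> carrier_vec (n * m)" using \<phi> by (simp add: adm_vec_def)
        from proj_index[OF this lt] show "proj (\<phi> l) $$ (i * m + a, j * m + b) = A l $$ (a, i) * cnj (A l $$ (b, j))"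
          using ij ab by (simp add: A_def coef_mat_def)
      qed simp
      finally show ?thesis .
    qed
    have "\<Phi> X $$ (a, b) = (\<Sum>i<n. \<Sum>j<n. \<Sum>l<N. X $$ (i, j) * (A l $$ (a, i) * cnj (A l $$ (b, j))))"
      by (simp add: lin_map_index[OF \<Phi> X ab] E sum_distrib_left)
    also have "\<dots> = (\<Sum>i<n. \<Sum>l<N. \<Sum>j<n. X $$ (i, j) * (A l $$ (a, i) * cnj (A l $$ (b, j))))"
      by (intro sum.cong refl sum.swap)
    also have "\<dots> = (\<Sum>l<N. \<Sum>i<n. \<Sum>j<n. X $$ (i, j) * (A l $$ (a, i) * cnj (A l $$ (b, j))))"
      by (rule sum.swap)
    also have "\<dots> = (\<Sum>l<N. (A l * X * mat_adjoint (A l)) $$ (a, b))"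
      by (simp only: kraus_index[OF A X ab])
    finally show "\<Phi> X $$ (a, b) = (\<Sum>l<N. (A l * X * mat_adjoint (A l)) $$ (a, b))" .
  qed
  ultimately show ?thesis using A by blast
qed

theorem theorem3p19:
  fixes n m :: nat and \<alpha> :: real and \<Phi> :: "complex mat \<Rightarrow> complex mat"
  assumes "1 \<le> \<alpha>" and "\<alpha> \<le> real (min n m)"
    and "lin_map n m \<Phi>"
  shows "(choi n m \<Phi> \<in> K_alpha n m \<alpha>
          \<longleftrightarrow> (\<exists>N::nat. \<exists>A :: nat \<Rightarrow> complex mat.
                 (\<forall>i<N. A i \<in> carrier_mat m n \<and> adm_mat \<alpha> (A i)) \<and>
                 (\<forall>X \<in> carrier_mat n n. \<Phi> X = msum m m (\<lambda>i. A i * X * mat_adjoint (A i)) N)))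
       \<and> (choi n m \<Phi> \<in> K_alpha n m \<alpha>
          \<longleftrightarrow> (\<exists>N::nat. \<exists>\<psi> :: nat \<Rightarrow> complex vec. \<exists>t :: nat \<Rightarrow> real.
                 (\<forall>i<N. \<psi> i \<in> V_alpha n m \<alpha> \<and> t i > 0) \<and>
                 choi n m \<Phi> = msum (n*m) (n*m) (\<lambda>i. complex_of_real (t i) \<cdot>\<^sub>m proj (\<psi> i)) N))
       \<and> (choi n m \<Phi> \<in> K_alpha n m \<alpha>
          \<longrightarrow> (\<exists>N::nat. N \<le> (n*m)\<^sup>2 \<and> (\<exists>\<psi> :: nat \<Rightarrow> complex vec. \<exists>t :: nat \<Rightarrow> real.
                 (\<forall>i<N. \<psi> i \<in> V_alpha n m \<alpha> \<and> t i > 0) \<and>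
                 choi n m \<Phi> = msum (n*m) (n*m) (\<lambda>i. complex_of_real (t i) \<cdot>\<^sub>m proj (\<psi> i)) N)))"
    (is "(?K \<longleftrightarrow> ?Kraus) \<and> (?K \<longleftrightarrow> (\<exists>N. ?Dec N)) \<and> (?K \<longrightarrow> (\<exists>N. N \<le> (n*m)\<^sup>2 \<and> ?Dec N))")
proof -
  \<comment> \<open>All implications pass through \<open>adm_decomp\<close>; starting from the
    closed cone already fixes the bound on the number of terms.\<close>
  have K_dec: "adm_decomp n m \<alpha> ((n*m)\<^sup>2) (choi n m \<Phi>)" if ?K
    using K_alpha_adm_decomp[OF that] .
  have dec_Dec: "\<exists>N'\<le>N. ?Dec N'" if "adm_decomp n m \<alpha> N (choi n m \<Phi>)" for N
    using adm_decomp_unit[OF that] .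
  have Dec_K: ?K if "?Dec N" for N
  proof (rule cone_alpha_subset_K_alpha)
    from that obtain \<psi> t where "\<forall>i<N. \<psi> i \<in> V_alpha n m \<alpha> \<and> t i > 0"
      "choi n m \<Phi> = msum (n*m) (n*m) (\<lambda>i. complex_of_real (t i) \<cdot>\<^sub>m proj (\<psi> i)) N"
        by blast
    thus "choi n m \<Phi> \<in> cone_alpha n m \<alpha>" unfolding cone_alpha_def by (blast intro: less_imp_le)
  qed
  have Kraus_K: ?K if ?Kraus
  proof -
    from that obtain N A where "\<And>i. i < N \<Longrightarrow> A i \<in> carrier_mat m n \<and> adm_mat \<alpha> (A i)"
      "\<And>X. X \<in> carrier_mat n n \<Longrightarrow> \<Phi> X = msum m m (\<lambda>i. A i * X * mat_adjoint (A i)) N"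
        by auto
    hence "adm_decomp n m \<alpha> N (choi n m \<Phi>)" by (rule adm_decomp_of_kraus)
    \<comment> \<open>Kraus vectors are not normalised, whereas the cone is generated by unit
      vectors.\<close>
    from dec_Dec[OF this] obtain N' where "N' \<le> N \<and> ?Dec N'" ..
    thus ?K by (intro Dec_K[of N']) (rule conjunct2)
  qed
  have K_Kraus: ?Kraus if ?K
    using kraus_of_adm_decomp[OF assms(3) K_dec[OF that]] by (rule exI)
  have K_Dec: "\<exists>N\<le>(n*m)\<^sup>2. ?Dec N" if ?K
    using dec_Dec[OF K_dec[OF that]] .
  show ?thesis
  proof (intro conjI iffI impI)
    show ?Kraus if ?K using that by (rule K_Kraus)
    show ?K if ?Kraus using that by (rule Kraus_K)
    show "\<exists>N. ?Dec N" if ?K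
    proof -
      from K_Dec[OF that] obtain N where "N \<le> (n*m)\<^sup>2 \<and> ?Dec N" ..
      hence "?Dec N" by (rule conjunct2)
      thus ?thesis by (rule exI)
    qed
    show ?K if "\<exists>N. ?Dec N"
    proof -
      from that obtain N where "?Dec N" ..
      thus ?K by (rule Dec_K)
    qed
    show "\<exists>N. N \<le> (n*m)\<^sup>2 \<and> ?Dec N" if ?K using that by (rule K_Dec)
  qed
qed

end
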